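(* Let $n,k,q$ be nonnegative integers and let $G$ be a graph with $|V(G)|=n$. (i) Suppose that $n\ge\max\{2k,\,2k+2-q\}$ and $\delta(G)\ge k\ge\max\{q-1,1\}$. If $\rho(\overline{G})\le\sqrt{(k+1-q)(n-k-1)}$, then $G$ is $q$-traceable, unless $G\in\mathbb{B}_{n,k,q-1,r}\cup\mathbb{H}_{n,k,q-1,r}$ for some $r$, or both $G=\overline{K_{1,k-1}}\vee\overline{K_{1,k-1}}$ and $q=k$. (ii) Suppose that $n\ge 3q-1$. If $\mu(\overline{G})\le n-q$, then $G$ is $q$-traceable unless $G\in\mathbb{C}_{n,q-1,r}\cup\mathbb{D}_{n,q-1,r}\cup\mathbb{W}_{n,q-1,r}$ for some $r$.
   Context: All graphs are finite, simple and undirected; equality of (or membership among) graphs is understood up to isomorphism. $\overline{G}$ is the complement and $\delta(G)$ the minimum degree of $G$. $A(G)$ is the adjacency matrix, $D(G)$ the diagonal degree matrix; $\rho(G)$ is the largest eigenvalue of $A(G)$ and $\mu(G)$ is the largest eigenvalue of $Q(G)=D(G)+A(G)$. The join $G\vee H$ of disjoint graphs is obtained from $G\cup H$ by adding all edges between $V(G)$ and $V(H)$; $K_0$ is the graph with no vertices, and conditions on it are regarded as vacuously true. A graph is traceable if it contains a spanning path (the graph with no vertices is regarded as traceable). $G$ is $q$-traceable if any removal of at most $q$ vertices from $G$ results in a traceable graph. A $(p,p')$-semi-regular bipartite graph is a bipartite graph with vertex bipartition $(U,V)$ in which every vertex of $U$ has degree $p$ and every vertex of $V$ has degree $p'$.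 Graph families, for an integer $s$ (used here with $s=q-1$; each is empty when its index conditions fail): - $\mathbb{B}_{n,k,s,r}$ ($0\le r\le s+1$, $r\ne 1$): all graphs $\overline{G_1}\vee G_2$ where $G_1$ is a connected $(k-s,n-k-1)$-semi-regular bipartite graph with $n-s-1+r$ vertices and $G_2$ is a spanning subgraph of $K_{s+1-r}$. - $\mathbb{H}_{n,k,s,r}$ (defined when $n=2k+1-s$ and $s\le 1$; $0\le r\le k$): all graphs $G_1\vee G_2$ where $G_1$ is an $r$-regular graph with $n-k+r$ vertices and $G_2$ is a spanning subgraph of $K_{k-r}$. - $\mathbb{C}_{n,s,r}$ ($0\le r\le s+1$, $r\neq 1$): all graphs $\overline{G_1}\vee G_2$ where, for some integer $p$ with $1\le p\le \frac{n-s-1}{2}$, $G_1$ is a connected $(p,n-s-1-p)$-semi-regular bipartite graph with $n-s-1+r$ vertices and $G_2$ is a spanning subgraph of $K_{s+1-r}$. - $\mathbb{D}_{n,s,r}$ ($0\le r\le s-1$): all graphs $(\overline{G_1}\vee\overline{G_2})\vee G_3$ where $G_1,G_2$ are two connected $\frac{n-s-1}{2}$-regular graphs with $|V(G_1)|+|V(G_2)|=n-r$ and $G_3$ is a spanning subgraph of $K_r$ with $\mu(\overline{G_3})\le n-s-1$. - $\mathbb{W}_{n,s,r}$ ($0\le r\le \frac{n+s-1}{2}$): all graphs $\overline{G_1}\vee G_2$ where $G_1$ is a connected $\frac{n-s-1}{2}$-regular graph with $n-r$ vertices and $G_2$ is a spanning subgraph of $K_r$ with $\mu(\overline{G_2})\le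 n-s-1$. *)

theory Defs
  imports "Graph_Theory.Graph_Theory" "Jordan_Normal_Form.Char_Poly"
begin

text \<open>
  A finite simple undirected graph is a \<open>pair_graph\<close>: finite, loop-free, and with a symmetric
  set of arcs, each edge \<open>uv\<close> being represented by the two arcs \<open>(u, v)\<close> and \<open>(v, u)\<close>. Hence
  \<open>out_degree (with_proj G) v\<close> is the usual degree of \<open>v\<close>. The graph without vertices is admitted.
\<close>

definition graph_complement :: "'a pair_pre_digraph \<Rightarrow> 'a pair_pre_digraph" where
  "graph_complement G =
     \<lparr> pverts = pverts G,
       parcs = {(u, v). u \<in> pverts G \<and> v \<in> pverts G \<and> u \<noteq> v \<and> (u, v) \<notin> parcs G} \<rparr>"

text \<open>Only meaningful for graphs with disjoint vertex sets.\<close>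
definition graph_join :: "'a pair_pre_digraph \<Rightarrow> 'a pair_pre_digraph \<Rightarrow> 'a pair_pre_digraph" where
  "graph_join G H =
     \<lparr> pverts = pverts G \<union> pverts H,
       parcs = parcs G \<union> parcs H \<union> pverts G \<times> pverts H \<union> pverts H \<times> pverts G \<rparr>"

definition min_degree :: "'a pair_pre_digraph \<Rightarrow> nat" where
  "min_degree G = Min (out_degree (with_proj G) ` pverts G)"

text \<open>
  Matrices are indexed by an arbitrary but fixed enumeration of the vertices; another
  enumeration yields a matrix conjugate by a permutation matrix, so the spectrum is unaffected.
\<close>
definition vertex_enum :: "'a pair_pre_digraph \<Rightarrow> 'a list" where
  "vertex_enum G = (SOME vs. distinct vs \<and> set vs = pverts G)"

definition adjacency_mat :: "'a pair_pre_digraph \<Rightarrow> real mat" where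
  "adjacency_mat G =
     mat (card (pverts G)) (card (pverts G))
       (\<lambda>(i, j). if (vertex_enum G ! i, vertex_enum G ! j) \<in> parcs G then 1 else 0)"

definition degree_mat :: "'a pair_pre_digraph \<Rightarrow> real mat" where
  "degree_mat G =
     mat (card (pverts G)) (card (pverts G))
       (\<lambda>(i, j). if i = j then real (out_degree (with_proj G) (vertex_enum G ! i)) else 0)"

text \<open>
  Both matrices are real symmetric, so their real eigenvalues are all their eigenvalues.
  The value for the graph without vertices is unspecified.
\<close>
definition adj_spectral_radius :: "'a pair_pre_digraph \<Rightarrow> real" where
  "adj_spectral_radius G = Max {x. eigenvalue (adjacency_mat G) x}"

definition signless_laplacian_radius :: "'a pair_pre_digraph \<Rightarrow> real" where
  "signless_laplacian_radius G = Max {x. eigenvalue (degree_mat G + adjacency_mat G) x}"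

definition traceable :: "('a, 'b) pre_digraph \<Rightarrow> bool" where
  "traceable G \<longleftrightarrow> verts G = {} \<or>
     (\<exists>u p v. pre_digraph.apath G u p v \<and> set (pre_digraph.awalk_verts G u p) = verts G)"

definition q_traceable :: "nat \<Rightarrow> 'a pair_pre_digraph \<Rightarrow> bool" where
  "q_traceable q G \<longleftrightarrow>
     (\<forall>S. S \<subseteq> pverts G \<and> card S \<le> q \<longrightarrow> traceable (with_proj G \<restriction> (pverts G - S)))"

definition regular_graph :: "int \<Rightarrow> 'a pair_pre_digraph \<Rightarrow> bool" where
  "regular_graph d G \<longleftrightarrow> pair_graph G \<and> (\<forall>v \<in> pverts G. int (out_degree (with_proj G) v) = d)"

definition semi_regular_bipartite :: "int \<Rightarrow> int \<Rightarrow> 'a pair_pre_digraph \<Rightarrow> bool" where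
  "semi_regular_bipartite p p' G \<longleftrightarrow> pair_graph G \<and>
     (\<exists>U V. pverts G = U \<union> V \<and> U \<inter> V = {} \<and> parcs G \<subseteq> U \<times> V \<union> V \<times> U \<and>
        (\<forall>u \<in> U. int (out_degree (with_proj G) u) = p) \<and>
        (\<forall>v \<in> V. int (out_degree (with_proj G) v) = p'))"

definition spanning_subgraph_of_complete :: "int \<Rightarrow> 'a pair_pre_digraph \<Rightarrow> bool" where
  "spanning_subgraph_of_complete m H \<longleftrightarrow> m \<ge> 0 \<and> pair_graph H \<and>
     (\<exists>K :: 'a pair_pre_digraph. complete_digraph (nat m) (with_proj K) \<and>
        spanning (with_proj H) (with_proj K))"

definition disjoint_graphs :: "'a pair_pre_digraph \<Rightarrow> 'a pair_pre_digraph \<Rightarrow> bool" where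
  "disjoint_graphs G H \<longleftrightarrow> pverts G \<inter> pverts H = {}"

text \<open>
  The families are closed under isomorphism. Requiring the constituents to have vertices in the
  same type as \<open>G\<close> is no restriction: an isomorphism carries them into \<open>G\<close> itself.
\<close>

definition family_B :: "int \<Rightarrow> int \<Rightarrow> int \<Rightarrow> int \<Rightarrow> 'a pair_pre_digraph set" where
  "family_B n k s r = {G. 0 \<le> r \<and> r \<le> s + 1 \<and> r \<noteq> 1 \<and>
     (\<exists>G1 G2 :: 'a pair_pre_digraph.
        Digraph_Component.connected (with_proj G1) \<and> semi_regular_bipartite (k - s) (n - k - 1) G1 \<and>
        int (card (pverts G1)) = n - s - 1 + r \<and>
        spanning_subgraph_of_complete (s + 1 - r) G2 \<and>
        disjoint_graphs G1 G2 \<and>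
        digraph_iso (with_proj G) (with_proj (graph_join (graph_complement G1) G2)))}"

definition family_H :: "int \<Rightarrow> int \<Rightarrow> int \<Rightarrow> int \<Rightarrow> 'a pair_pre_digraph set" where
  "family_H n k s r = {G. n = 2 * k + 1 - s \<and> s \<le> 1 \<and> 0 \<le> r \<and> r \<le> k \<and>
     (\<exists>G1 G2 :: 'a pair_pre_digraph.
        regular_graph r G1 \<and>
        int (card (pverts G1)) = n - k + r \<and>
        spanning_subgraph_of_complete (k - r) G2 \<and>
        disjoint_graphs G1 G2 \<and>
        digraph_iso (with_proj G) (with_proj (graph_join G1 G2)))}"

definition family_C :: "int \<Rightarrow> int \<Rightarrow> int \<Rightarrow> 'a pair_pre_digraph set" where
  "family_C n s r = {G. 0 \<le> r \<and> r \<le> s + 1 \<and> r \<noteq> 1 \<and>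
     (\<exists>p. \<exists>G1 G2 :: 'a pair_pre_digraph.
        1 \<le> p \<and> 2 * p \<le> n - s - 1 \<and>
        Digraph_Component.connected (with_proj G1) \<and> semi_regular_bipartite p (n - s - 1 - p) G1 \<and>
        int (card (pverts G1)) = n - s - 1 + r \<and>
        spanning_subgraph_of_complete (s + 1 - r) G2 \<and>
        disjoint_graphs G1 G2 \<and>
        digraph_iso (with_proj G) (with_proj (graph_join (graph_complement G1) G2)))}"

text \<open>In the next two families \<open>d\<close> is \<open>(n - s - 1) / 2\<close>, which has to be an integer.\<close>

definition family_D :: "int \<Rightarrow> int \<Rightarrow> int \<Rightarrow> 'a pair_pre_digraph set" where
  "family_D n s r = {G. 0 \<le> r \<and> r \<le> s - 1 \<and>
     (\<exists>d. \<exists>G1 G2 G3 :: 'a pair_pre_digraph.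
        2 * d = n - s - 1 \<and>
        Digraph_Component.connected (with_proj G1) \<and> regular_graph d G1 \<and>
        Digraph_Component.connected (with_proj G2) \<and> regular_graph d G2 \<and>
        int (card (pverts G1)) + int (card (pverts G2)) = n - r \<and>
        spanning_subgraph_of_complete r G3 \<and>
        (pverts G3 \<noteq> {} \<longrightarrow>
           signless_laplacian_radius (graph_complement G3) \<le> real_of_int (n - s - 1)) \<and>
        disjoint_graphs G1 G2 \<and> disjoint_graphs G1 G3 \<and> disjoint_graphs G2 G3 \<and>
        digraph_iso (with_proj G)
          (with_proj (graph_join (graph_join (graph_complement G1) (graph_complement G2)) G3)))}"

definition family_W :: "int \<Rightarrow> int \<Rightarrow> int \<Rightarrow> 'a pair_pre_digraph set" where
  "family_W n s r = {G. 0 \<le> r \<and> 2 * r \<le> n + s - 1 \<and>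
     (\<exists>d. \<exists>G1 G2 :: 'a pair_pre_digraph.
        2 * d = n - s - 1 \<and>
        Digraph_Component.connected (with_proj G1) \<and> regular_graph d G1 \<and>
        int (card (pverts G1)) = n - r \<and>
        spanning_subgraph_of_complete r G2 \<and>
        (pverts G2 \<noteq> {} \<longrightarrow>
           signless_laplacian_radius (graph_complement G2) \<le> real_of_int (n - s - 1)) \<and>
        disjoint_graphs G1 G2 \<and>
        digraph_iso (with_proj G) (with_proj (graph_join (graph_complement G1) G2)))}"

text \<open>The single graph obtained by joining the complements of two disjoint stars on \<open>k\<close> vertices.\<close>
definition join_of_costars :: "nat \<Rightarrow> 'a pair_pre_digraph \<Rightarrow> bool" where
  "join_of_costars k G \<longleftrightarrow>
     (\<exists>S1 S2 :: 'a pair_pre_digraph.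
        complete_bipartite_digraph 1 (k - 1) (with_proj S1) \<and>
        complete_bipartite_digraph 1 (k - 1) (with_proj S2) \<and>
        disjoint_graphs S1 S2 \<and>
        digraph_iso (with_proj G)
          (with_proj (graph_join (graph_complement S1) (graph_complement S2))))"

end

theory Submission
  imports Defs "HOL-Analysis.Function_Topology"
begin

text \<open>
  Suppose that \<open>G\<close> is not \<open>q\<close>-traceable, say \<open>G\<close> without the vertices of \<open>S\<close> has no spanning path,
  where \<open>S\<close> has at most \<open>q\<close> vertices. Add edges to \<open>G\<close> as long as this remains so, and let \<open>F\<close>
  consist of the edges still missing at the end: it is a nonempty part of the complement \<open>B\<close> of \<open>G\<close>.
  Ore's rotation argument shows that no missing edge has endpoints of large degree; read in the
  complement, this says that \<open>d\<^sub>F u + d\<^sub>F v \<ge> n - q\<close> for every edge \<open>uv\<close> of \<open>F\<close>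
  (\<open>not_q_traceable_heavy_coedges\<close>).

  A bound on a largest eigenvalue bounds a quadratic form (\<open>max_eigenvalue_le_iff\<close>), hence a sum over
  the edges of \<open>B\<close>, for every vector. Testing it on a vector made from the degrees \<open>d\<^sub>F\<close> meets the
  lower bound on the degrees of \<open>F\<close> with no room to spare:
  \<^item> for the signless Laplacian, \<open>x\<^sub>v = d\<^sub>F v\<close> gives \<open>\<Sum>\<^sub>u\<^sub>v (d\<^sub>F u + d\<^sub>F v)\<^sup>2 \<le> (n - q) \<Sum>\<^sub>u\<^sub>v (d\<^sub>F u + d\<^sub>F v)\<close>,
    so every edge of \<open>F\<close> has degree sum exactly \<open>n - q\<close>;
  \<^item> for the adjacency matrix, \<open>x\<^sub>v = sqrt (d\<^sub>F v)\<close> gives degree products equal to \<open>a b\<close>, where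
    \<open>a = k + 1 - q\<close> and \<open>b = n - 1 - k\<close>; as no degree exceeds \<open>b\<close>, the two degrees are \<open>a\<close> and \<open>b\<close>.

  In both cases equality also forces every edge of \<open>B\<close> with an end covered by \<open>F\<close> to lie in \<open>F\<close>, so
  the component of \<open>B\<close> through a vertex covered by \<open>F\<close> has constant degree sum along its edges
  (\<open>arcs_equal_of_degree_sums\<close>, \<open>arcs_equal_of_degree_products\<close>). This replaces the Perron-Frobenius
  theorem, which is otherwise the usual tool here.

  A connected graph with constant degree sum \<open>c\<close> along its edges is regular of degree \<open>c / 2\<close> or
  semi-regular bipartite with degrees \<open>p\<close> and \<open>c - p\<close>. One such component of the complement is enough
  to place \<open>G\<close> in a family: \<open>G\<close> is the join of the complement of that component with the rest of \<open>G\<close>,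
  and the rest may be any graph satisfying the size and spectral conditions. For the first part, the
  component puts \<open>G\<close> into \<open>family_B\<close> if \<open>a < b\<close>, and if \<open>a = b\<close> the set of all vertices covered by \<open>F\<close>
  puts it into \<open>family_H\<close>. For the second part, a semi-regular component leads to \<open>family_C\<close> and a
  regular one to \<open>family_W\<close>.
\<close>

section \<open>Removing an edge from a spanning path\<close>

definition spanning_path :: "'a set \<Rightarrow> 'a rel \<Rightarrow> bool" where
  "spanning_path T E \<longleftrightarrow> (\<exists>xs. distinct xs \<and> set xs = T \<and> successively (\<lambda>x y. (x, y) \<in> E) xs)"

text \<open>Ore's rotation for paths. Let \<open>A\<close> end in \<open>u\<close> and \<open>B\<close> begin with \<open>v\<close>; the pair \<open>uv\<close> itself need not be
  an edge. A new spanning path arises by reversing a segment whenever \<open>u\<close> is adjacent to the last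
  vertex, or \<open>v\<close> to the first one, or \<open>u\<close> to some vertex of \<open>A @ B\<close> and \<open>v\<close> to its successor. If none
  of this happens, then the successors of the neighbours of \<open>u\<close> and the neighbours of \<open>v\<close> are disjoint
  sets of positions, and both miss the first position and that of \<open>v\<close>, so they are too few.\<close>

lemma spanning_path_join_segments:
  fixes E :: "'a rel"
  assumes E: "sym E" "irrefl E"
    and path: "distinct (A @ B)" "A \<noteq> []" "B \<noteq> []"
      "successively (\<lambda>x y. (x, y) \<in> E) A" "successively (\<lambda>x y. (x, y) \<in> E) B"
    and ore: "card (E `` {last A} \<inter> set (A @ B)) + card (E `` {hd B} \<inter> set (A @ B)) + 1
                \<ge> card (set (A @ B))"
  shows "spanning_path (set (A @ B)) E"
proof (rule ccontr)
  define u v N i x where "u = last A" and "v = hd B" and "N = length (A @ B)"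
    and "i = length A - 1" and "x = (\<lambda>t. (A @ B) ! t)"
  assume none: "\<not> ?thesis"
  have not_path: "\<not> successively (\<lambda>x y. (x, y) \<in> E) ys" if "distinct ys" "set ys = set (A @ B)" for ys
    using none that unfolding spanning_path_def by blast
  have symE: "(b, a) \<in> E" if "(a, b) \<in> E" for a b using E(1) that by (meson symE)
  have rev_succ: "successively (\<lambda>x y. (x, y) \<in> E) (rev ys)" if "successively (\<lambda>x y. (x, y) \<in> E) ys" for ys
    using that symE by (auto simp: successively_rev elim: successively_mono)
  have iN: "Suc i < N" "0 < length A" "Suc i = length A" using path unfolding i_def N_def by (cases A; cases B; simp)+
  have xi: "x i = u" using path iN unfolding x_def u_def i_def by (simp add: nth_append last_conv_nth)
  have xSi: "x (Suc i) = v" using path iN unfolding x_def v_def by (simp add: nth_append hd_conv_nth)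
  have bij: "bij_betw x {..<N} (set (A @ B))"
    using path(1) unfolding x_def N_def by (intro bij_betw_nth) auto
  have count: "card (E `` {w} \<inter> set (A @ B)) = card {t. t < N \<and> (w, x t) \<in> E}" for w
  proof -
    have "bij_betw x {t. t < N \<and> (w, x t) \<in> E} (E `` {w} \<inter> set (A @ B))"
      unfolding bij_betw_def
    proof
      show "inj_on x {t. t < N \<and> (w, x t) \<in> E}"
        using bij unfolding bij_betw_def by (rule_tac inj_on_subset[of x "{..<N}"]) auto
      show "x ` {t. t < N \<and> (w, x t) \<in> E} = E `` {w} \<inter> set (A @ B)"
        using bij unfolding bij_betw_def by (fastforce simp: image_iff)
    qed
    then show ?thesis by (simp add: bij_betw_same_card)
  qed
  have last: "(u, x (N - 1)) \<notin> E"
  proof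
    assume "(u, x (N - 1)) \<in> E"
    moreover have "x (N - 1) = last B"
      using path(2,3) unfolding x_def N_def
      by (metis last_appendR append_is_Nil_conv last_conv_nth)
    ultimately have "successively (\<lambda>x y. (x, y) \<in> E) (A @ rev B)"
      using path rev_succ unfolding u_def by (simp add: successively_append_iff hd_rev)
    then show False using not_path[of "A @ rev B"] path(1) by simp
  qed
  have first: "(v, x 0) \<notin> E"
  proof
    assume "(v, x 0) \<in> E"
    moreover have "x 0 = hd A"
      using path(2) unfolding x_def by (simp add: nth_append hd_conv_nth)
    ultimately have "successively (\<lambda>x y. (x, y) \<in> E) (rev A @ B)"
      using path rev_succ[OF path(4)] symE unfolding v_def by (simp add: successively_append_iff last_rev)
    then show False using not_path[of "rev A @ B"] path(1) by simp
  qed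
  have crossing: "\<not> ((u, x t) \<in> E \<and> (v, x (Suc t)) \<in> E)" if t: "Suc t < N" for t
  proof
    assume adj: "(u, x t) \<in> E \<and> (v, x (Suc t)) \<in> E"
    have "t \<noteq> i" using adj xi E(2) by (auto simp: irrefl_def)
    then consider "Suc t \<le> i" | "i < t" by linarith
    then show False
    proof cases
      case 1
      define A1 A2 where "A1 = take (Suc t) A" and "A2 = drop (Suc t) A"
      have A: "A = A1 @ A2" "A1 \<noteq> []" "A2 \<noteq> []" "last A1 = x t" "hd A2 = x (Suc t)"
        using 1 iN unfolding A1_def A2_def x_def
        by (auto simp: last_conv_nth hd_drop_conv_nth nth_append min_def)
      have "successively (\<lambda>x y. (x, y) \<in> E) (A1 @ rev A2 @ B)"
        using path A adj rev_succ[of A2] symE unfolding u_def v_def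
        by (auto simp: successively_append_iff hd_rev last_rev)
      then show False using not_path[of "A1 @ rev A2 @ B"] path(1) A(1) by auto
    next
      case 2
      define B1 B2 where "B1 = take (t - i) B" and "B2 = drop (t - i) B"
      have len: "t - i < length B" using t 2 iN unfolding N_def by auto
      have idx: "Suc t - length A = t - i" "t - length A = t - i - 1" "length A \<le> t" using 2 iN by auto
      have B: "B = B1 @ B2" "B1 \<noteq> []" "B2 \<noteq> []"
        using len 2 unfolding B1_def B2_def by auto
      have ends: "last B1 = x t" "hd B2 = x (Suc t)"
        using len 2 B idx unfolding B1_def B2_def x_def
        by (auto simp: last_conv_nth hd_drop_conv_nth nth_append min_def)
      have "successively (\<lambda>x y. (x, y) \<in> E) (A @ rev B1 @ B2)"
        using path B ends adj rev_succ[of B1] symE unfolding u_def v_def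
        by (auto simp: successively_append_iff hd_rev last_rev)
      then show False using not_path[of "A @ rev B1 @ B2"] path(1) B(1) by auto
    qed
  qed
  \<comment> \<open>Neighbour sets as sets of positions, shifted by one for \<open>u\<close>; position \<open>Suc i\<close> is that of \<open>v\<close>.\<close>
  define P Q where "P = {t. t < N \<and> (u, x t) \<in> E}" and "Q = {t. t < N \<and> (v, x t) \<in> E}"
  have fin: "finite P" "finite Q" unfolding P_def Q_def by auto
  have "Suc t < N" if "t \<in> P" for t
    using that last unfolding P_def by (cases "t = N - 1") auto
  then have PQ: "Suc ` P \<inter> Q = {}" "Suc ` P \<subseteq> {1..<N} - {Suc i}"
    using crossing xi E(2) unfolding P_def Q_def by (auto simp: irrefl_def)
  have "Q \<subseteq> {1..<N} - {Suc i}"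
    using first xSi E(2) unfolding Q_def irrefl_def by (auto simp: Suc_le_eq intro: gr0I)
  then have "card (Suc ` P \<union> Q) \<le> card ({1..<N} - {Suc i})"
    using PQ by (intro card_mono) auto
  also have "\<dots> = N - 2" using iN by (subst card_Diff_singleton) auto
  finally have "card P + card Q \<le> N - 2"
    using PQ fin by (simp add: card_Un_disjoint card_image)
  moreover have "card (set (A @ B)) = N" using path(1) unfolding N_def by (rule distinct_card)
  moreover have "card (E `` {last A} \<inter> set (A @ B)) = card P"
      "card (E `` {hd B} \<inter> set (A @ B)) = card Q"
    using count unfolding P_def Q_def u_def v_def by auto
  ultimately show False using ore iN by linarith
qed

text \<open>A spanning path that uses the new edge falls into two segments when that edge is deleted.\<close>

lemma spanning_path_remove_edge:
  fixes E :: "'a rel"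
  assumes E: "sym E" "irrefl E" and uv: "u \<noteq> v"
    and path: "spanning_path T (E \<union> {(u, v), (v, u)})"
    and ore: "card (E `` {u} \<inter> T) + card (E `` {v} \<inter> T) + 1 \<ge> card T"
  shows "spanning_path T E"
proof (rule ccontr)
  let ?E = "\<lambda>x y. (x, y) \<in> E"
  assume none: "\<not> ?thesis"
  obtain xs where xs: "distinct xs" "set xs = T"
      "successively (\<lambda>x y. (x, y) \<in> E \<union> {(u, v), (v, u)}) xs"
    using path unfolding spanning_path_def by blast
  then have "\<not> successively ?E xs" using none unfolding spanning_path_def by blast
  then obtain i where i: "Suc i < length xs" "(xs ! i, xs ! Suc i) \<notin> E"
    by (auto simp: successively_conv_nth)
  have step: "(xs ! j, xs ! Suc j) \<in> E \<union> {(u, v), (v, u)}" if "Suc j < length xs" for j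
    using xs(3) that by (auto simp: successively_conv_nth)
  have new: "{xs ! i, xs ! Suc i} = {u, v}" using step[OF i(1)] i(2) by auto
  \<comment> \<open>The new edge occurs only once, since the vertices of the path are distinct.\<close>
  have other: "(xs ! j, xs ! Suc j) \<in> E" if j: "Suc j < length xs" "j \<noteq> i" for j
  proof (rule ccontr)
    assume "(xs ! j, xs ! Suc j) \<notin> E"
    then have "{xs ! j, xs ! Suc j} = {xs ! i, xs ! Suc i}" using step[OF j(1)] new by auto
    then have "xs ! j = xs ! i \<or> (xs ! j = xs ! Suc i \<and> xs ! Suc j = xs ! i)"
      by (auto simp: doubleton_eq_iff)
    then show False using xs(1) i(1) j by (auto simp: nth_eq_iff_index_eq)
  qed
  define A B where "A = take (Suc i) xs" and "B = drop (Suc i) xs"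
  have AB: "xs = A @ B" "A \<noteq> []" "B \<noteq> []"
    using i(1) unfolding A_def B_def by auto
  have ends: "last A = xs ! i" "hd B = xs ! Suc i"
    using i(1) unfolding A_def B_def by (auto simp: take_Suc_conv_app_nth hd_drop_conv_nth)
  have "successively ?E A" "successively ?E B"
    unfolding A_def B_def successively_conv_nth using other by auto
  moreover have "card (E `` {last A} \<inter> T) + card (E `` {hd B} \<inter> T) + 1 \<ge> card T"
    using ore new ends by (auto simp: doubleton_eq_iff)
  ultimately have "spanning_path (set (A @ B)) E"
    using xs AB E by (intro spanning_path_join_segments) auto
  then show False using none AB xs by auto
qed

text \<open>\<open>B\<close> is the set of non-edges of a graph without a spanning path on \<open>T\<close>, and \<open>F\<close> is a minimal subset
  with the same property, that is, the complement of an edge-maximal such graph. Restoring any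
  pair of \<open>F\<close> creates a spanning path, so the degrees of its ends are small in the graph and
  large in \<open>F\<close>.\<close>

lemma nontraceable_heavy_coedges:
  fixes B :: "'a rel"
  assumes fin: "finite T" and B: "sym B" "irrefl B"
    and none: "\<not> spanning_path T {(u, v). u \<noteq> v \<and> (u, v) \<notin> B}"
    and finB: "finite B"
  obtains F where "F \<subseteq> B" "sym F" "F \<noteq> {}"
    "\<And>u v. (u, v) \<in> F \<Longrightarrow> card (F `` {u}) + card (F `` {v}) \<ge> card T"
proof -
  let ?co = "\<lambda>F. {(u, v). u \<noteq> v \<and> (u, v) \<notin> F}"
  define good where "good F \<longleftrightarrow> F \<subseteq> B \<and> sym F \<and> \<not> spanning_path T (?co F)" for F
  have "good B" using none B unfolding good_def by auto
  then obtain F where F: "good F" and min: "\<And>F'. good F' \<Longrightarrow> card F \<le> card F'"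
    using ex_has_least_nat[of good B card] by auto
  have finF: "finite F" using F finB unfolding good_def by (auto intro: finite_subset)
  have "card T \<le> card (F `` {u}) + card (F `` {v})" if uv: "(u, v) \<in> F" "u \<noteq> v" for u v
  proof -
    let ?F' = "F - {(u, v), (v, u)}"
    have symF: "sym F" using F good_def by auto
    have vu: "(v, u) \<in> F" using symF uv by (auto dest: symD)
    have "card ?F' < card F" using finF uv by (intro psubset_card_mono) auto
    then have "\<not> good ?F'" using min by (meson leD)
    moreover have "sym ?F'" using symF by (auto simp: sym_def)
    ultimately have "spanning_path T (?co ?F')" using F unfolding good_def by auto
    moreover have "?co ?F' = ?co F \<union> {(u, v), (v, u)}" using uv by auto
    ultimately have path: "spanning_path T (?co F \<union> {(u, v), (v, u)})" by simp
    have "sym (?co F)" "irrefl (?co F)" using symF by (auto simp: sym_def irrefl_def)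
    then have small: "card (?co F `` {u} \<inter> T) + card (?co F `` {v} \<inter> T) + 1 < card T"
      using spanning_path_remove_edge[OF _ _ uv(2) path] F unfolding good_def by (meson not_le)
    have deg: "card T \<le> card (?co F `` {w} \<inter> T) + 1 + card (F `` {w})" for w
    proof -
      have finw: "finite (F `` {w})" using finF by (rule finite_Image)
      have "T \<subseteq> (?co F `` {w} \<inter> T) \<union> {w} \<union> F `` {w}" by auto
      then have "card T \<le> card ((?co F `` {w} \<inter> T) \<union> {w} \<union> F `` {w})"
        using fin finw by (intro card_mono) auto
      also have "\<dots> \<le> card ((?co F `` {w} \<inter> T) \<union> {w}) + card (F `` {w})" by (rule card_Un_le)
      also have "\<dots> \<le> card (?co F `` {w} \<inter> T) + card {w} + card (F `` {w})"
        using card_Un_le[of "?co F `` {w} \<inter> T" "{w}"] by linarith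
      finally show ?thesis by simp
    qed
    show ?thesis using small deg[of u] deg[of v] by linarith
  qed
  moreover have "u \<noteq> v" if "(u, v) \<in> F" for u v
    using that F B(2) unfolding good_def irrefl_def by auto
  moreover have "F \<noteq> {}"
  proof
    assume "F = {}"
    obtain xs where xs: "set xs = T" "distinct xs" using fin finite_distinct_list by blast
    then have "successively (\<lambda>x y. (x, y) \<in> ?co F) xs"
      using \<open>F = {}\<close> by (auto simp: successively_conv_nth nth_eq_iff_index_eq)
    then show False using F xs unfolding good_def spanning_path_def by blast
  qed
  ultimately show thesis using that F unfolding good_def by blast
qed

section \<open>Rayleigh quotients\<close>

text \<open>Vectors and matrices are functions on the vertices here, so that the form can be tested on vectors
  given in terms of the graph without reference to an enumeration.\<close>

definition bilinear_sum :: "'a set \<Rightarrow> ('a \<Rightarrow> 'a \<Rightarrow> real) \<Rightarrow> ('a \<Rightarrow> real) \<Rightarrow> ('a \<Rightarrow> real) \<Rightarrow> real" where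
  "bilinear_sum V m x y = (\<Sum>u\<in>V. \<Sum>v\<in>V. m u v * x u * y v)"

text \<open>Near \<open>t = 0\<close> the linear term dominates and changes sign with \<open>t\<close>; the witness below minimises the
  quadratic with \<open>q\<close> replaced by \<open>q + 1\<close>, which avoids a division by zero.\<close>

lemma nonneg_on_line_imp_linear_coeff_zero:
  fixes b q :: real
  assumes "\<And>t. 0 \<le> 2 * t * b + t\<^sup>2 * q"
  shows "b = 0"
proof (rule ccontr)
  assume "b \<noteq> 0"
  have "q \<ge> 0" using assms[of 1] assms[of "-1"] by simp
  define d t where "d = q + 1" and "t = - b / d"
  have d: "d > 0" "t * d = - b" using \<open>q \<ge> 0\<close> unfolding d_def t_def by auto
  have "(2 * t * b + t\<^sup>2 * q) * d\<^sup>2 = 2 * (t * d) * b * d + (t * d)\<^sup>2 * q"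
    by (simp add: algebra_simps power2_eq_square)
  also have "\<dots> = - (b\<^sup>2 * (q + 2))"
    unfolding d(2) by (simp add: d_def algebra_simps power2_eq_square)
  also have "\<dots> < 0" using \<open>b \<noteq> 0\<close> \<open>q \<ge> 0\<close> by simp
  finally show False using assms[of t] d(1) by (simp add: mult_less_0_iff)
qed

lemma sum_squares_pos:
  fixes x :: "'a \<Rightarrow> real"
  assumes "finite V" "\<exists>v\<in>V. x v \<noteq> 0"
  shows "(\<Sum>v\<in>V. (x v)\<^sup>2) > 0"
proof -
  obtain v where "v \<in> V" "x v \<noteq> 0" using assms(2) by blast
  then show ?thesis using assms(1) by (intro sum_pos2[of V v]) auto
qed

text \<open>The form \<open>c |y|\<^sup>2 - y\<^sup>T m y\<close> is nonnegative and vanishes at \<open>x\<close>, so its derivative at \<open>x\<close> in the direction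
  of each basis vector vanishes.\<close>

lemma rayleigh_equality_imp_eigenvector:
  fixes m :: "'a \<Rightarrow> 'a \<Rightarrow> real"
  assumes V: "finite V" and sym: "\<And>u v. u \<in> V \<Longrightarrow> v \<in> V \<Longrightarrow> m u v = m v u"
    and le: "\<And>y. bilinear_sum V m y y \<le> c * (\<Sum>v\<in>V. (y v)\<^sup>2)"
    and eq: "bilinear_sum V m x x = c * (\<Sum>v\<in>V. (x v)\<^sup>2)"
    and w: "w \<in> V"
  shows "(\<Sum>v\<in>V. m w v * x v) = c * x w"
proof -
  define e where "e = (\<lambda>v. if v = w then 1 else 0 :: real)"
  define b where "b = c * x w - (\<Sum>v\<in>V. m w v * x v)"
  have "(\<Sum>v\<in>V. m u v * e u * x v) = (if u = w then \<Sum>v\<in>V. m w v * x v else 0)" for u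
    by (simp add: e_def)
  then have left: "bilinear_sum V m e x = (\<Sum>v\<in>V. m w v * x v)"
    unfolding bilinear_sum_def using V w by simp
  have "bilinear_sum V m x e = bilinear_sum V m e x"
    unfolding bilinear_sum_def
    by (subst sum.swap) (auto intro!: sum.cong simp: sym mult_ac)
  note right = this[unfolded left]
  have "0 \<le> 2 * t * b + t\<^sup>2 * (c - m w w)" for t
  proof -
    define y where "y = (\<lambda>v. x v + t * e v)"
    have "m u v * y u * y v = m u v * x u * x v + t * (m u v * x u * e v)
        + t * (m u v * e u * x v) + t\<^sup>2 * (m u v * e u * e v)" for u v
      unfolding y_def by (simp add: algebra_simps power2_eq_square)
    then have "bilinear_sum V m y y = bilinear_sum V m x x + t * bilinear_sum V m x e
        + t * bilinear_sum V m e x + t\<^sup>2 * bilinear_sum V m e e"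
      unfolding bilinear_sum_def by (simp only: sum.distrib sum_distrib_left)
    moreover have "bilinear_sum V m e e = m w w"
      proof -
      have "(\<Sum>v\<in>V. m u v * e u * e v) = (if u = w then m w w else 0)" for u
      proof -
        have "(\<Sum>v\<in>V. m u v * e u * e v) = (\<Sum>v\<in>V. if v = w then m u w * e u else 0)"
          by (intro sum.cong) (auto simp: e_def)
        then show ?thesis using V w by (simp add: e_def)
      qed
      then show ?thesis unfolding bilinear_sum_def using V w by simp
    qed
    moreover have "(\<Sum>v\<in>V. (y v)\<^sup>2) = (\<Sum>v\<in>V. (x v)\<^sup>2) + 2 * t * x w + t\<^sup>2"
    proof -
      have "(\<Sum>v\<in>V. (y v)\<^sup>2) = (\<Sum>v\<in>V. (x v)\<^sup>2 + (if v = w then 2 * t * x w + t\<^sup>2 else 0))"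
        unfolding y_def e_def by (intro sum.cong) (auto simp: power2_eq_square algebra_simps)
      then show ?thesis using V w by (simp add: sum.distrib)
    qed
    ultimately show ?thesis
      using le[of y] eq left right unfolding b_def by (simp add: algebra_simps)
  qed
  then have "b = 0" by (rule nonneg_on_line_imp_linear_coeff_zero)
  then show ?thesis unfolding b_def by simp
qed

text \<open>The form attains its maximum on the unit sphere by compactness, and a maximum point is an eigenvector
  by the previous lemma. Values off \<open>V\<close> do not affect the form; they are fixed to \<open>0\<close> to keep the
  set of candidates compact in the product topology.\<close>

lemma symmetric_form_has_top_eigenvector:
  fixes m :: "'a \<Rightarrow> 'a \<Rightarrow> real"
  assumes V: "finite V" "V \<noteq> {}" and sym: "\<And>u v. u \<in> V \<Longrightarrow> v \<in> V \<Longrightarrow> m u v = m v u"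
  obtains x c where "(\<Sum>v\<in>V. (x v)\<^sup>2) = 1" "\<And>w. w \<in> V \<Longrightarrow> (\<Sum>v\<in>V. m w v * x v) = c * x w"
    "\<And>y. bilinear_sum V m y y \<le> c * (\<Sum>v\<in>V. (y v)\<^sup>2)"
proof -
  define S where "S = {x :: 'a \<Rightarrow> real. (\<Sum>v\<in>V. (x v)\<^sup>2) = 1}"
  \<comment> \<open>A compact box that contains the sphere once the values off \<open>V\<close> are fixed.\<close>
  define box where "box = (PiE UNIV (\<lambda>v. if v \<in> V then {-1..1} else {0 :: real}))"
  have "compact box"
    unfolding box_def compactin_euclidean_iff[symmetric] euclidean_product_topology[symmetric]
    by (subst compactin_PiE) (auto simp: compactin_euclidean_iff)
  moreover have cont: "continuous_on UNIV (\<lambda>x :: 'a \<Rightarrow> real. \<Sum>v\<in>V. (x v)\<^sup>2)"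
    by (intro continuous_intros continuous_on_product_coordinates)
  have "closed S"
    unfolding S_def using continuous_closed_preimage_constant[OF cont closed_UNIV, of 1] by simp
  ultimately have "compact (box \<inter> S)" by (rule compact_Int_closed)
  moreover have "box \<inter> S \<noteq> {}"
  proof -
    obtain w where "w \<in> V" using V by auto
    moreover have "(if v = w then 1 else 0 :: real)\<^sup>2 = (if v = w then 1 else 0)" for v by simp
    ultimately have "(\<lambda>v. if v = w then 1 else 0) \<in> box \<inter> S"
      unfolding box_def S_def using V by (auto split: if_splits)
    then show ?thesis by blast
  qed
  moreover have "continuous_on (box \<inter> S) (\<lambda>x. bilinear_sum V m x x)"
    unfolding bilinear_sum_def
    by (intro continuous_intros continuous_on_subset[OF continuous_on_product_coordinates]) auto
  ultimately obtain x where x: "x \<in> box \<inter> S"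
      and max: "\<And>y. y \<in> box \<inter> S \<Longrightarrow> bilinear_sum V m y y \<le> bilinear_sum V m x x"
    using continuous_attains_sup[of "box \<inter> S" "\<lambda>x. bilinear_sum V m x x"] by auto
  define c where "c = bilinear_sum V m x x"
  have le: "bilinear_sum V m y y \<le> c * (\<Sum>v\<in>V. (y v)\<^sup>2)" for y
  proof (cases "\<forall>v\<in>V. y v = 0")
    case True
    then show ?thesis unfolding bilinear_sum_def by simp
  next
    case False
    define r where "r = sqrt (\<Sum>v\<in>V. (y v)\<^sup>2)"
    have sumpos: "(\<Sum>v\<in>V. (y v)\<^sup>2) > 0"
      using False V by (intro sum_squares_pos) auto
    then have r: "r > 0" "r\<^sup>2 = (\<Sum>v\<in>V. (y v)\<^sup>2)" unfolding r_def by auto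
    define z where "z = (\<lambda>v. if v \<in> V then y v / r else 0)"
    have norm: "(\<Sum>v\<in>V. (z v)\<^sup>2) = 1"
      using r sumpos unfolding z_def by (simp add: power_divide flip: sum_divide_distrib)
    have "z v \<in> {-1..1}" if "v \<in> V" for v
    proof -
      have "(z v)\<^sup>2 \<le> (\<Sum>v\<in>V. (z v)\<^sup>2)" using V that by (intro member_le_sum) auto
      then have "\<bar>z v\<bar> \<le> 1" using norm by (simp add: abs_square_le_1)
      then show ?thesis by auto
    qed
    then have "z \<in> box \<inter> S" using norm unfolding box_def S_def z_def by auto
    then have "bilinear_sum V m z z \<le> c" using max unfolding c_def by blast
    moreover have "bilinear_sum V m z z = bilinear_sum V m y y / r\<^sup>2"
      unfolding bilinear_sum_def z_def
      by (simp add: sum_divide_distrib power2_eq_square cong: sum.cong)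
    ultimately show ?thesis using r sumpos by (simp add: pos_divide_le_eq)
  qed
  show thesis
  proof (rule that)
    show norm: "(\<Sum>v\<in>V. (x v)\<^sup>2) = 1" using x unfolding S_def by auto
    show "(\<Sum>v\<in>V. m w v * x v) = c * x w" if "w \<in> V" for w
      using V sym le that norm by (intro rayleigh_equality_imp_eigenvector) (auto simp: c_def)
    show "\<And>y. bilinear_sum V m y y \<le> c * (\<Sum>v\<in>V. (y v)\<^sup>2)" by (rule le)
  qed
qed

lemma eigenvalue_iff_function:
  fixes m :: "'a \<Rightarrow> 'a \<Rightarrow> real"
  assumes vs: "distinct vs" "set vs = V"
    and M: "M = mat (card V) (card V) (\<lambda>(i, j). m (vs ! i) (vs ! j))"
  shows "eigenvalue M c \<longleftrightarrow>
    (\<exists>x. (\<exists>v\<in>V. x v \<noteq> 0) \<and> (\<forall>w\<in>V. (\<Sum>v\<in>V. m w v * x v) = c * x w))"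
proof -
  define n where "n = card V"
  have n: "length vs = n" using distinct_card[OF vs(1)] vs(2) unfolding n_def by simp
  have bij: "bij_betw ((!) vs) {0..<n} V"
    using vs n by (intro bij_betw_nth) auto
  have ball: "(\<forall>w\<in>V. P w) \<longleftrightarrow> (\<forall>i<n. P (vs ! i))" for P
    unfolding vs(2)[symmetric] n[symmetric] by (rule all_set_conv_all_nth)
  have row: "(M *\<^sub>v vec n (\<lambda>i. x (vs ! i))) $ i = (\<Sum>v\<in>V. m (vs ! i) v * x v)" if "i < n" for x i
  proof -
    have "(M *\<^sub>v vec n (\<lambda>i. x (vs ! i))) $ i = (\<Sum>j\<in>{0..<n}. m (vs ! i) (vs ! j) * x (vs ! j))"
      using that unfolding M n_def[symmetric] by (simp add: scalar_prod_def)
    also have "\<dots> = (\<Sum>v\<in>V. m (vs ! i) v * x v)"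
      by (rule sum.reindex_bij_betw[OF bij])
    finally show ?thesis .
  qed
  have dim: "dim_row M = n" unfolding M n_def by simp
  have eq: "M *\<^sub>v vec n (\<lambda>i. x (vs ! i)) = c \<cdot>\<^sub>v vec n (\<lambda>i. x (vs ! i))
      \<longleftrightarrow> (\<forall>w\<in>V. (\<Sum>v\<in>V. m w v * x v) = c * x w)" for x
  proof -
    have "M *\<^sub>v vec n (\<lambda>i. x (vs ! i)) = c \<cdot>\<^sub>v vec n (\<lambda>i. x (vs ! i))
      \<longleftrightarrow> (\<forall>i<n. (\<Sum>v\<in>V. m (vs ! i) v * x v) = c * x (vs ! i))"
      using row dim by (auto simp: vec_eq_iff)
    also have "\<dots> \<longleftrightarrow> (\<forall>w\<in>V. (\<Sum>v\<in>V. m w v * x v) = c * x w)"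
      by (rule ball[symmetric])
    finally show ?thesis .
  qed
  have zero: "vec n (\<lambda>i. x (vs ! i)) \<noteq> 0\<^sub>v n \<longleftrightarrow> (\<exists>v\<in>V. x v \<noteq> 0)" for x
  proof -
    have "vec n (\<lambda>i. x (vs ! i)) \<noteq> 0\<^sub>v n \<longleftrightarrow> (\<exists>i<n. x (vs ! i) \<noteq> 0)"
      by (auto simp: vec_eq_iff)
    also have "\<dots> \<longleftrightarrow> (\<exists>v\<in>V. x v \<noteq> 0)" using ball[of "\<lambda>v. x v = 0"] by auto
    finally show ?thesis .
  qed
  show ?thesis
  proof
    assume "eigenvalue M c"
    then obtain y where y: "y \<in> carrier_vec n" "y \<noteq> 0\<^sub>v n" "M *\<^sub>v y = c \<cdot>\<^sub>v y"
      unfolding eigenvalue_def eigenvector_def dim by auto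
    define x where "x v = y $ the_inv_into {0..<n} ((!) vs) v" for v
    have "x (vs ! i) = y $ i" if "i < n" for i
      using bij that unfolding x_def bij_betw_def by (auto simp: the_inv_into_f_f)
    then have y_eq: "y = vec n (\<lambda>i. x (vs ! i))" using y(1) by (intro eq_vecI) auto
    show "\<exists>x. (\<exists>v\<in>V. x v \<noteq> 0) \<and> (\<forall>w\<in>V. (\<Sum>v\<in>V. m w v * x v) = c * x w)"
      using y(2) y(3) zero[of x] eq[of x] unfolding y_eq[symmetric] by blast
  next
    assume "\<exists>x. (\<exists>v\<in>V. x v \<noteq> 0) \<and> (\<forall>w\<in>V. (\<Sum>v\<in>V. m w v * x v) = c * x w)"
    then obtain x where "\<exists>v\<in>V. x v \<noteq> 0" "\<forall>w\<in>V. (\<Sum>v\<in>V. m w v * x v) = c * x w" by blast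
    then show "eigenvalue M c"
      using zero[of x] eq[of x] unfolding eigenvalue_def eigenvector_def dim
      by (intro exI[of _ "vec n (\<lambda>i. x (vs ! i))"] conjI vec_carrier) blast+
  qed
qed

text \<open>The eigenvalue of a top eigenvector dominates the form, hence is the largest one. In particular there
  is an eigenvalue, so that the maximum is taken over a nonempty finite set.\<close>

lemma max_eigenvalue_le_iff:
  fixes m :: "'a \<Rightarrow> 'a \<Rightarrow> real"
  assumes V: "V \<noteq> {}" and vs: "distinct vs" "set vs = V"
    and M: "M = mat (card V) (card V) (\<lambda>(i, j). m (vs ! i) (vs ! j))"
    and sym: "\<And>u v. u \<in> V \<Longrightarrow> v \<in> V \<Longrightarrow> m u v = m v u"
  shows "Max {c. eigenvalue M c} \<le> b \<longleftrightarrow>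
    (\<forall>y. bilinear_sum V m y y \<le> b * (\<Sum>v\<in>V. (y v)\<^sup>2))"
proof -
  have fin: "finite V" using vs by auto
  have "M \<in> carrier_mat (card V) (card V)" unfolding M by simp
  then have "{c. eigenvalue M c} = {c. poly (char_poly M) c = 0}" "char_poly M \<noteq> 0"
    using eigenvalue_root_char_poly[of M "card V"] degree_monic_char_poly[of M "card V"] by auto
  then have finE: "finite {c. eigenvalue M c}" using poly_roots_finite by auto
  obtain x c where x: "(\<Sum>v\<in>V. (x v)\<^sup>2) = 1" "\<And>w. w \<in> V \<Longrightarrow> (\<Sum>v\<in>V. m w v * x v) = c * x w"
      and top: "\<And>y. bilinear_sum V m y y \<le> c * (\<Sum>v\<in>V. (y v)\<^sup>2)"
  proof (rule symmetric_form_has_top_eigenvector[of V m])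
    show "m u v = m v u" if "u \<in> V" "v \<in> V" for u v using that by (rule sym)
  qed (use fin V in \<open>auto\<close>)
  have "\<exists>v\<in>V. x v \<noteq> 0" 
  proof (rule ccontr)
    assume "\<not> (\<exists>v\<in>V. x v \<noteq> 0)"
    then have "(\<Sum>v\<in>V. (x v)\<^sup>2) = 0" by (intro sum.neutral) auto
    then show False using x(1) by simp
  qed
  then have ev: "eigenvalue M c" using x(2) unfolding eigenvalue_iff_function[where m=m, OF vs M] by blast
  have eigen_form: "bilinear_sum V m y y = d * (\<Sum>v\<in>V. (y v)\<^sup>2)"
    if "\<forall>w\<in>V. (\<Sum>v\<in>V. m w v * y v) = d * y w" for y d
  proof -
    have "bilinear_sum V m y y = (\<Sum>u\<in>V. y u * (\<Sum>v\<in>V. m u v * y v))"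
      unfolding bilinear_sum_def by (simp add: sum_distrib_left mult_ac)
    also have "\<dots> = (\<Sum>u\<in>V. d * (y u)\<^sup>2)" using that by (intro sum.cong) (auto simp: power2_eq_square)
    finally show ?thesis by (simp add: sum_distrib_left)
  qed
  show ?thesis
  proof
    assume "Max {c. eigenvalue M c} \<le> b"
    then have "c \<le> b" using Max_ge[OF finE, of c] ev by simp
    show "\<forall>y. bilinear_sum V m y y \<le> b * (\<Sum>v\<in>V. (y v)\<^sup>2)"
    proof
      fix y
      have "c * (\<Sum>v\<in>V. (y v)\<^sup>2) \<le> b * (\<Sum>v\<in>V. (y v)\<^sup>2)"
        using \<open>c \<le> b\<close> by (intro mult_right_mono sum_nonneg) auto
      then show "bilinear_sum V m y y \<le> b * (\<Sum>v\<in>V. (y v)\<^sup>2)" using top[of y] by linarith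
    qed
  next
    assume form: "\<forall>y. bilinear_sum V m y y \<le> b * (\<Sum>v\<in>V. (y v)\<^sup>2)"
    have "d \<le> b" if "eigenvalue M d" for d
    proof -
      have "\<exists>x. (\<exists>v\<in>V. x v \<noteq> 0) \<and> (\<forall>w\<in>V. (\<Sum>v\<in>V. m w v * x v) = d * x w)"
        using that eigenvalue_iff_function[where m=m, OF vs M] by simp
      then obtain y where y: "\<exists>v\<in>V. y v \<noteq> 0" "\<forall>w\<in>V. (\<Sum>v\<in>V. m w v * y v) = d * y w"
        by blast
      have "(\<Sum>v\<in>V. (y v)\<^sup>2) > 0"
        using y(1) fin by (intro sum_squares_pos) auto
      moreover have "d * (\<Sum>v\<in>V. (y v)\<^sup>2) \<le> b * (\<Sum>v\<in>V. (y v)\<^sup>2)"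
        using form[rule_format, of y] unfolding eigen_form[OF y(2)] .
      ultimately show ?thesis by (simp add: mult_le_cancel_right)
    qed
    then show "Max {c. eigenvalue M c} \<le> b" using finE ev by (subst Max_le_iff) auto
  qed
qed

section \<open>Induced graphs and traceability\<close>

text \<open>\<open>E\<close> may be the arc relation of a graph or of its complement, which are both restricted to vertex
  sets below.\<close>

definition induced_graph :: "'a set \<Rightarrow> 'a rel \<Rightarrow> 'a pair_pre_digraph" where
  "induced_graph C E = \<lparr> pverts = C, parcs = E \<inter> C \<times> C \<rparr>"

lemma induced_graph_simps [simp]:
  "pverts (induced_graph C E) = C" "parcs (induced_graph C E) = E \<inter> C \<times> C"
  by (simp_all add: induced_graph_def)

lemma pair_graph_iff:
  "pair_graph G \<longleftrightarrow> finite (pverts G) \<and> parcs G \<subseteq> pverts G \<times> pverts G \<and> sym (parcs G) \<and> irrefl (parcs G)"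
proof
  assume "pair_graph G"
  then interpret pair_graph G .
  show "finite (pverts G) \<and> parcs G \<subseteq> pverts G \<times> pverts G \<and> sym (parcs G) \<and> irrefl (parcs G)"
    using pair_finite_verts in_arcsD1 in_arcsD2 arcs_symmetric no_loops'
    unfolding sym_def irrefl_def by fast
next
  assume G: "finite (pverts G) \<and> parcs G \<subseteq> pverts G \<times> pverts G \<and> sym (parcs G) \<and> irrefl (parcs G)"
  then have "finite (parcs G)" by (meson finite_SigmaI finite_subset)
  then show "pair_graph G"
    using G by unfold_locales (auto simp: symmetric_def irrefl_def)
qed

lemma pair_graph_induced:
  assumes "finite C" "sym E" "irrefl E"
  shows "pair_graph (induced_graph C E)"
  using assms unfolding pair_graph_iff by (auto simp: sym_def irrefl_def)

lemma pair_graph_complement: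
  assumes "pair_graph G"
  shows "pair_graph (graph_complement G)"
  using assms unfolding pair_graph_iff graph_complement_def by (auto simp: sym_def irrefl_def)

lemma out_degree_eq_card_Image: "out_degree (with_proj G) v = card (parcs G `` {v})"
proof -
  have "bij_betw snd {e \<in> parcs G. fst e = v} (parcs G `` {v})"
    by (auto simp: bij_betw_def inj_on_def image_iff)
  then show ?thesis
    unfolding out_degree_def out_arcs_def by (simp add: bij_betw_same_card)
qed

text \<open>Traceability speaks of walks as lists of arcs; the arcs of a walk with vertex list \<open>xs\<close> are
  \<open>zip xs (tl xs)\<close>.\<close>

lemma traceable_induced_if_spanning_path:
  assumes "spanning_path T (parcs G)"
  shows "traceable (with_proj G \<restriction> T)"
proof (cases "T = {}")
  case True
  then show ?thesis unfolding traceable_def by simp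
next
  case False
  have restrict: "with_proj G \<restriction> T = with_proj (induced_graph T (parcs G))"
    by (auto simp: induce_subgraph_def with_proj_def)
  interpret H: pair_pre_digraph "induced_graph T (parcs G)" .
  obtain xs where xs: "distinct xs" "set xs = T" "successively (\<lambda>x y. (x, y) \<in> parcs G) xs"
    using assms unfolding spanning_path_def by blast
  have walk: "ys \<noteq> [] \<and> set ys \<subseteq> T \<and> successively (\<lambda>x y. (x, y) \<in> parcs G) ys \<Longrightarrow>
      pawalk_verts (hd ys) (zip ys (tl ys)) = ys \<and> pcas (hd ys) (zip ys (tl ys)) (last ys) \<and>
      set (zip ys (tl ys)) \<subseteq> parcs (induced_graph T (parcs G))" for ys
  proof (induction ys rule: induct_list012)
    case (3 x y zs)
    then show ?case by auto
  qed auto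
  have ne: "xs \<noteq> []" using xs(2) False by auto
  define es where "es = zip xs (tl xs)"
  have es: "pawalk_verts (hd xs) es = xs" "pcas (hd xs) es (last xs)"
      "set es \<subseteq> parcs (induced_graph T (parcs G))"
    using walk[of xs] xs(2,3) ne unfolding es_def by blast+
  have "H.apath (hd xs) es (last xs)"
    unfolding H.apath_def H.awalk_def using es xs(1,2) ne by auto
  moreover have "set (pre_digraph.awalk_verts (with_proj (induced_graph T (parcs G))) (hd xs) es)
      = verts (with_proj (induced_graph T (parcs G)))"
    using es(1) xs(2) by (simp add: awalk_verts_with_proj_eq)
  ultimately show ?thesis unfolding traceable_def restrict by blast
qed

text \<open>The degree bound for the remaining \<open>n - card S\<close> vertices already gives what is needed for \<open>G\<close>,
  because \<open>card S \<le> q\<close> and degrees in \<open>F\<close> are taken over all vertices.\<close>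

lemma not_q_traceable_heavy_coedges:
  assumes G: "pair_graph G" and none: "\<not> q_traceable q G"
  defines "B \<equiv> parcs (graph_complement G)"
  obtains F where "F \<subseteq> B" "sym F" "F \<noteq> {}"
    "\<And>u v. (u, v) \<in> F \<Longrightarrow> card (pverts G) \<le> card (F `` {u}) + card (F `` {v}) + q"
proof -
  have V: "finite (pverts G)" and graphB: "pair_graph (graph_complement G)"
    using G pair_graph_complement by (auto simp: pair_graph_iff)
  obtain S where S: "S \<subseteq> pverts G" "card S \<le> q" "\<not> traceable (with_proj G \<restriction> (pverts G - S))"
    using none unfolding q_traceable_def by blast
  define T where "T = pverts G - S"
  have B: "sym B" "irrefl B" "finite B"
    using graphB V unfolding pair_graph_iff B_def by (auto intro: finite_subset)
  have "\<not> spanning_path T {(u, v). u \<noteq> v \<and> (u, v) \<notin> B}"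
  proof
    assume "spanning_path T {(u, v). u \<noteq> v \<and> (u, v) \<notin> B}"
    then obtain xs where xs: "distinct xs" "set xs = T"
        "successively (\<lambda>x y. (x, y) \<in> {(u, v). u \<noteq> v \<and> (u, v) \<notin> B}) xs"
      unfolding spanning_path_def by blast
    have "successively (\<lambda>x y. (x, y) \<in> parcs G) xs"
      using xs(3)
    proof (rule successively_mono)
      show "(x, y) \<in> parcs G" if "x \<in> set xs" "y \<in> set xs" "(x, y) \<in> {(u, v). u \<noteq> v \<and> (u, v) \<notin> B}" for x y
        using that xs(2) unfolding B_def T_def graph_complement_def by auto
    qed
    then have "spanning_path T (parcs G)" using xs unfolding spanning_path_def by blast
    then show False using traceable_induced_if_spanning_path S(3) unfolding T_def by blast
  qed
  then obtain F where F: "F \<subseteq> B" "sym F" "F \<noteq> {}"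
      "\<And>u v. (u, v) \<in> F \<Longrightarrow> card T \<le> card (F `` {u}) + card (F `` {v})"
    using nontraceable_heavy_coedges[of T B] B V unfolding T_def by blast
  have "card (pverts G) \<le> card T + q"
    using S V unfolding T_def by (simp add: card_Diff_subset finite_subset)
  then have "card (pverts G) \<le> card (F `` {u}) + card (F `` {v}) + q" if "(u, v) \<in> F" for u v
    using F(4)[OF that] by linarith
  then show thesis using that F(1-3) by blast
qed

section \<open>Spectral radii as bounds on sums over arcs\<close>

lemma vertex_enum:
  assumes "finite (pverts G)"
  shows "distinct (vertex_enum G)" "set (vertex_enum G) = pverts G"
  using someI_ex[of "\<lambda>vs. distinct vs \<and> set vs = pverts G"] finite_distinct_list[OF assms]
  unfolding vertex_enum_def by blast+

lemma sum_arcs_by_source: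
  fixes f :: "'a \<Rightarrow> real"
  assumes "finite V" "E \<subseteq> V \<times> V"
  shows "(\<Sum>(u, v)\<in>E. f u) = (\<Sum>u\<in>V. card (E `` {u}) * f u)"
proof -
  have E: "E = Sigma V (\<lambda>u. E `` {u})" using assms(2) by auto
  have "finite (E `` {u})" for u using assms by (meson finite_Image finite_SigmaI finite_subset)
  then have "(\<Sum>u\<in>V. \<Sum>v\<in>E `` {u}. f u) = (\<Sum>(u, v)\<in>Sigma V (\<lambda>u. E `` {u}). f u)"
    using assms(1) by (intro sum.Sigma) auto
  then show ?thesis using E by simp
qed

lemma sum_arcs_swap:
  assumes "sym E"
  shows "(\<Sum>(u, v)\<in>E. f v u) = (\<Sum>(u, v)\<in>E. f u v)"
  by (rule sum.reindex_bij_witness[where i = prod.swap and j = prod.swap])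
     (use assms in \<open>auto simp: sym_def\<close>)

lemma bilinear_sum_indicator:
  fixes x y :: "'a \<Rightarrow> real"
  assumes "finite V" "E \<subseteq> V \<times> V"
  shows "bilinear_sum V (\<lambda>u v. if (u, v) \<in> E then 1 else 0) x y = (\<Sum>(u, v)\<in>E. x u * y v)"
proof -
  have "bilinear_sum V (\<lambda>u v. if (u, v) \<in> E then 1 else 0) x y
      = (\<Sum>(u, v)\<in>V \<times> V. if (u, v) \<in> E then x u * y v else 0)"
    unfolding bilinear_sum_def sum.cartesian_product by (intro sum.cong) auto
  also have "\<dots> = (\<Sum>(u, v)\<in>E. if (u, v) \<in> E then x u * y v else 0)"
    using assms by (intro sum.mono_neutral_right) auto
  also have "\<dots> = (\<Sum>(u, v)\<in>E. x u * y v)" by (intro sum.cong) auto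
  finally show ?thesis .
qed

lemma adj_spectral_radius_le_iff:
  assumes G: "pair_graph G" and ne: "pverts G \<noteq> {}"
  shows "adj_spectral_radius G \<le> b \<longleftrightarrow>
    (\<forall>x. (\<Sum>(u, v)\<in>parcs G. x u * x v) \<le> b * (\<Sum>v\<in>pverts G. (x v)\<^sup>2))"
proof -
  have *: "finite (pverts G)" "parcs G \<subseteq> pverts G \<times> pverts G" "sym (parcs G)"
    using G by (auto simp: pair_graph_iff)
  show ?thesis
    unfolding adj_spectral_radius_def bilinear_sum_indicator[OF *(1,2), symmetric]
    by (rule max_eigenvalue_le_iff[OF ne vertex_enum[OF *(1)]])
       (use *(3) in \<open>auto simp: adjacency_mat_def sym_def\<close>)
qed

text \<open>The signless Laplacian form is \<open>\<Sum> (x\<^sub>u + x\<^sub>v)\<^sup>2\<close> over the edges; the factor 2 appears because each edge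
  contributes two arcs.\<close>

lemma signless_laplacian_radius_le_iff:
  assumes G: "pair_graph G" and ne: "pverts G \<noteq> {}"
  shows "signless_laplacian_radius G \<le> b \<longleftrightarrow>
    (\<forall>x. (\<Sum>(u, v)\<in>parcs G. (x u + x v)\<^sup>2) \<le> 2 * b * (\<Sum>v\<in>pverts G. (x v)\<^sup>2))"
proof -
  let ?V = "pverts G" and ?E = "parcs G"
  have *: "finite ?V" "?E \<subseteq> ?V \<times> ?V" "sym ?E" "irrefl ?E"
    using G by (auto simp: pair_graph_iff)
  define A D where "A = (\<lambda>u v. if (u, v) \<in> ?E then 1 else 0 :: real)"
    and "D = (\<lambda>u v. if u = v then real (card (?E `` {u})) else 0)"
  define m where "m = (\<lambda>u v. D u v + A u v)"
  have M: "degree_mat G + adjacency_mat G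
      = mat (card ?V) (card ?V) (\<lambda>(i, j). m (vertex_enum G ! i) (vertex_enum G ! j))"
    using vertex_enum[OF *(1)] distinct_card[OF vertex_enum(1)[OF *(1)]]
    unfolding degree_mat_def adjacency_mat_def m_def D_def A_def out_degree_eq_card_Image
    by (intro eq_matI) (auto simp: nth_eq_iff_index_eq)
  have form: "(\<Sum>(u, v)\<in>?E. (x u + x v)\<^sup>2) = 2 * bilinear_sum ?V m x x" for x
  proof -
    have "(\<Sum>(u, v)\<in>?E. (x u + x v)\<^sup>2)
        = (\<Sum>(u, v)\<in>?E. (x u)\<^sup>2) + (\<Sum>(u, v)\<in>?E. (x v)\<^sup>2) + 2 * (\<Sum>(u, v)\<in>?E. x u * x v)"
      by (simp add: case_prod_unfold power2_sum sum.distrib sum_distrib_left mult.assoc)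
    also have "(\<Sum>(u, v)\<in>?E. (x v)\<^sup>2) = (\<Sum>(u, v)\<in>?E. (x u)\<^sup>2)"
      by (rule sum_arcs_swap[OF *(3)])
    also have "(\<Sum>(u, v)\<in>?E. (x u)\<^sup>2) = (\<Sum>u\<in>?V. card (?E `` {u}) * (x u)\<^sup>2)"
      by (rule sum_arcs_by_source[OF *(1,2)])
    also have "(\<Sum>(u, v)\<in>?E. x u * x v) = bilinear_sum ?V A x x"
      unfolding A_def by (rule bilinear_sum_indicator[OF *(1,2), symmetric])
    also have "(\<Sum>u\<in>?V. card (?E `` {u}) * (x u)\<^sup>2) = bilinear_sum ?V D x x"
    proof -
      have "(\<Sum>v\<in>?V. D u v * x u * x v) = card (?E `` {u}) * (x u)\<^sup>2" if "u \<in> ?V" for u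
      proof -
        have "(\<Sum>v\<in>?V. D u v * x u * x v)
            = (\<Sum>v\<in>?V. if u = v then card (?E `` {u}) * x u * x v else 0)"
          by (intro sum.cong) (auto simp: D_def)
        then show ?thesis using that *(1) by (simp add: power2_eq_square)
      qed
      then show ?thesis unfolding bilinear_sum_def by simp
    qed
    finally show ?thesis
      unfolding m_def bilinear_sum_def by (simp add: distrib_right sum.distrib)
  qed
  have "m u v = m v u" for u v using *(3) unfolding m_def D_def A_def by (auto simp: sym_def)
  then have "signless_laplacian_radius G \<le> b \<longleftrightarrow>
      (\<forall>x. bilinear_sum ?V m x x \<le> b * (\<Sum>v\<in>?V. (x v)\<^sup>2))"
    unfolding signless_laplacian_radius_def
    using max_eigenvalue_le_iff[OF ne vertex_enum[OF *(1)] M] by simp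
  then show ?thesis unfolding form by (simp add: mult.assoc)
qed

section \<open>Equality in the edge-wise degree bounds\<close>

lemma exI2: "P x y \<Longrightarrow> \<exists>x y. P x y"
  by blast

text \<open>With \<open>x\<^sub>v = d\<^sub>F v\<close> and \<open>y\<^sub>u\<^sub>v = x\<^sub>u + x\<^sub>v\<close>, double counting gives \<open>2 |x|\<^sup>2 = \<Sum> y\<close> over the arcs of \<open>F\<close>. Hence the bound
  on the form says that \<open>\<Sum> y (y - c)\<close> over \<open>F\<close> plus \<open>\<Sum> y\<^sup>2\<close> over \<open>B - F\<close> is at most \<open>0\<close>, whereas all these
  terms are nonnegative.\<close>

lemma arcs_equal_of_degree_sums:
  assumes V: "finite V" "B \<subseteq> V \<times> V" and F: "F \<subseteq> B" "sym F"
    and heavy: "\<And>u v. (u, v) \<in> F \<Longrightarrow> c \<le> card (F `` {u}) + card (F `` {v})"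
    and form: "\<And>x. (\<Sum>(u, v)\<in>B. (x u + x v)\<^sup>2) \<le> 2 * real c * (\<Sum>v\<in>V. (x v)\<^sup>2)"
  shows "(u, v) \<in> F \<Longrightarrow> card (F `` {u}) + card (F `` {v}) = c"
    and "(u, v) \<in> B \<Longrightarrow> F `` {u} \<noteq> {} \<Longrightarrow> (u, v) \<in> F"
proof -
  define x where "x = (\<lambda>v. real (card (F `` {v})))"
  define y where "y = (\<lambda>(u, v). x u + x v)"
  have finB: "finite B" using V by (meson finite_SigmaI finite_subset)
  have finF: "finite F" using finB F(1) by (rule finite_subset[rotated])
  have y_ge: "real c \<le> y e" if "e \<in> F" for e
    using heavy[of "fst e" "snd e"] that unfolding x_def y_def
    by (cases e) (simp flip: of_nat_add)
  have y_pos: "0 < y (u, v)" if "F `` {u} \<noteq> {}" for u v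
    using that finF unfolding x_def y_def by (auto intro!: add_pos_nonneg simp: card_gt_0_iff)
  have norm: "2 * (\<Sum>v\<in>V. (x v)\<^sup>2) = (\<Sum>e\<in>F. y e)"
  proof -
    have "(\<Sum>e\<in>F. y e) = (\<Sum>(u, v)\<in>F. x u) + (\<Sum>(u, v)\<in>F. x v)"
      unfolding y_def by (simp add: case_prod_unfold sum.distrib)
    also have "(\<Sum>(u, v)\<in>F. x v) = (\<Sum>(u, v)\<in>F. x u)"
      by (rule sum_arcs_swap[OF F(2)])
    also have "(\<Sum>(u, v)\<in>F. x u) = (\<Sum>u\<in>V. card (F `` {u}) * x u)"
      using V F(1) by (intro sum_arcs_by_source) auto
    also have "\<dots> = (\<Sum>v\<in>V. (x v)\<^sup>2)" unfolding x_def by (simp add: power2_eq_square)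
    finally show ?thesis by simp
  qed
  have "(\<Sum>e\<in>B. (y e)\<^sup>2) = (\<Sum>e\<in>F. (y e)\<^sup>2) + (\<Sum>e\<in>B - F. (y e)\<^sup>2)"
    using sum.subset_diff[OF F(1) finB] by (simp add: add.commute)
  moreover have "(\<Sum>e\<in>B. (y e)\<^sup>2) \<le> real c * (\<Sum>e\<in>F. y e)"
    using form[of x] norm unfolding y_def by (simp add: case_prod_unfold mult.assoc mult.left_commute)
  moreover have "(\<Sum>e\<in>F. y e * (y e - real c)) = (\<Sum>e\<in>F. (y e)\<^sup>2) - real c * (\<Sum>e\<in>F. y e)"
    by (simp add: sum_distrib_left sum_subtractf algebra_simps power2_eq_square)
  ultimately have le: "(\<Sum>e\<in>F. y e * (y e - real c)) + (\<Sum>e\<in>B - F. (y e)\<^sup>2) \<le> 0"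
    by linarith
  have y_nonneg: "0 \<le> y e" for e unfolding y_def x_def by (simp add: case_prod_unfold)
  have ge1: "0 \<le> y e * (y e - real c)" if "e \<in> F" for e using y_ge[OF that] y_nonneg[of e] by simp
  have nn: "0 \<le> (\<Sum>e\<in>F. y e * (y e - real c))" "0 \<le> (\<Sum>e\<in>B - F. (y e)\<^sup>2)"
    using ge1 by (auto intro: sum_nonneg)
  then have eq0: "(\<Sum>e\<in>F. y e * (y e - real c)) = 0" "(\<Sum>e\<in>B - F. (y e)\<^sup>2) = 0"
    using le by linarith+
  have zeroF: "y e * (y e - real c) = 0" if "e \<in> F" for e
    using eq0(1) sum_nonneg_eq_0_iff[OF finF, of "\<lambda>e. y e * (y e - real c)"] ge1 that by auto
  have zeroBF: "y e = 0" if "e \<in> B - F" for e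
    using eq0(2) sum_nonneg_eq_0_iff[of "B - F" "\<lambda>e. (y e)\<^sup>2"] finB that by auto
  show "card (F `` {u}) + card (F `` {v}) = c" if uv: "(u, v) \<in> F"
  proof -
    have "F `` {u} \<noteq> {}" using uv by auto
    then have "y (u, v) = real c" using zeroF[OF uv] y_pos[of u v] by auto
    then show ?thesis unfolding y_def x_def by (simp flip: of_nat_add)
  qed
  show "(u, v) \<in> F" if "(u, v) \<in> B" "F `` {u} \<noteq> {}"
    using zeroBF[of "(u, v)"] y_pos[OF that(2), of v] that(1) by fastforce
qed

text \<open>With \<open>x\<^sub>v = sqrt (d\<^sub>F v)\<close> the squared norm of \<open>x\<close> is the number of arcs of \<open>F\<close>, so the bound on the form
  is attained, each arc of \<open>F\<close> contributing exactly \<open>c\<close> and each arc of \<open>B - F\<close> nothing. The latter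
  only shows that an arc of \<open>B - F\<close> has one end not covered by \<open>F\<close>. That its other end is not covered
  either follows since \<open>x\<close> is an eigenvector: at a vertex where \<open>x\<close> vanishes, the sum of \<open>x\<close> over
  the neighbours vanishes too.\<close>

lemma arcs_equal_of_degree_products:
  fixes c :: real
  assumes V: "finite V" "B \<subseteq> V \<times> V" "sym B" and F: "F \<subseteq> B" "sym F"
    and c: "0 \<le> c"
    and heavy: "\<And>u v. (u, v) \<in> F \<Longrightarrow> c\<^sup>2 \<le> real (card (F `` {u})) * real (card (F `` {v}))"
    and form: "\<And>x. (\<Sum>(u, v)\<in>B. x u * x v) \<le> c * (\<Sum>v\<in>V. (x v)\<^sup>2)"
  shows "(u, v) \<in> F \<Longrightarrow> real (card (F `` {u})) * real (card (F `` {v})) = c\<^sup>2"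
    and "(u, v) \<in> B \<Longrightarrow> F `` {u} \<noteq> {} \<Longrightarrow> (u, v) \<in> F"
proof -
  define x where "x = (\<lambda>v. sqrt (card (F `` {v})))"
  define y where "y = (\<lambda>(u, v). x u * x v)"
  have finB: "finite B" using V by (meson finite_SigmaI finite_subset)
  have finF: "finite F" using finB F(1) by (rule finite_subset[rotated])
  have y_ge: "c \<le> y e" if "e \<in> F" for e
  proof -
    have "c\<^sup>2 \<le> (y e)\<^sup>2"
      using heavy[of "fst e" "snd e"] that unfolding x_def y_def
      by (cases e) (simp add: power_mult_distrib)
    then show ?thesis by (rule power2_le_imp_le) (simp add: y_def x_def case_prod_unfold)
  qed
  have x_pos: "0 < x u \<longleftrightarrow> F `` {u} \<noteq> {}" for u
    using finF unfolding x_def by (auto simp: card_gt_0_iff)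
  have x_nonneg: "0 \<le> x u" for u unfolding x_def by simp
  have "(\<Sum>(u, v)\<in>F. 1) = (\<Sum>u\<in>V. card (F `` {u}) * (1 :: real))"
    using V F(1) by (intro sum_arcs_by_source) auto
  then have norm: "(\<Sum>v\<in>V. (x v)\<^sup>2) = real (card F)"
    unfolding x_def by (simp add: case_prod_unfold)
  have split: "(\<Sum>e\<in>B. y e) = (\<Sum>e\<in>F. y e) + (\<Sum>e\<in>B - F. y e)"
    using sum.subset_diff[OF F(1) finB] by (simp add: add.commute)
  have le_form: "(\<Sum>e\<in>B. y e) \<le> c * real (card F)"
    using form[of x] norm unfolding y_def by simp
  have diff: "(\<Sum>e\<in>F. y e - c) = (\<Sum>e\<in>F. y e) - c * real (card F)"
    by (simp add: sum_subtractf)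
  have ynn: "0 \<le> y e" for e unfolding y_def using x_nonneg by (simp add: case_prod_unfold)
  have nn: "0 \<le> (\<Sum>e\<in>F. y e - c)" "0 \<le> (\<Sum>e\<in>B - F. y e)"
    using y_ge ynn by (auto intro: sum_nonneg)
  then have eq0: "(\<Sum>e\<in>F. y e - c) = 0" "(\<Sum>e\<in>B - F. y e) = 0"
    and eq_form: "(\<Sum>e\<in>B. y e) = c * real (card F)"
    using split le_form diff by linarith+
  have zeroF: "y e = c" if "e \<in> F" for e
    using eq0(1) sum_nonneg_eq_0_iff[OF finF, of "\<lambda>e. y e - c"] y_ge that by auto
  have zeroBF: "y e = 0" if "e \<in> B - F" for e
    using eq0(2) sum_nonneg_eq_0_iff[of "B - F" y] finB ynn that by auto
  show "real (card (F `` {u})) * real (card (F `` {v})) = c\<^sup>2" if "(u, v) \<in> F"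
    using zeroF[OF that] unfolding y_def x_def
    by (simp add: real_sqrt_mult[symmetric]) (metis real_sqrt_pow2 mult_nonneg_nonneg of_nat_0_le_iff)
  show "(u, v) \<in> F" if uv: "(u, v) \<in> B" and u: "F `` {u} \<noteq> {}"
  proof (rule ccontr)
    assume notF: "(u, v) \<notin> F"
    then have "x u * x v = 0" using zeroBF[of "(u, v)"] uv unfolding y_def by auto
    then have xv: "x v = 0" using x_pos[of u] u by auto
    define m where "m = (\<lambda>u v. if (u, v) \<in> B then 1 else 0 :: real)"
    have bil: "bilinear_sum V m z z = (\<Sum>(u, v)\<in>B. z u * z v)" for z
      unfolding m_def by (rule bilinear_sum_indicator[OF V(1,2)])
    have vV: "v \<in> V" "u \<in> V" using uv V(2) by auto
    have "(\<Sum>w\<in>V. m v w * x w) = c * x v"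
    proof (rule rayleigh_equality_imp_eigenvector[OF V(1)])
      show "m a b = m b a" for a b using V(3) unfolding m_def by (auto simp: sym_def)
      show "bilinear_sum V m z z \<le> c * (\<Sum>v\<in>V. (z v)\<^sup>2)" for z unfolding bil by (rule form)
      show "bilinear_sum V m x x = c * (\<Sum>v\<in>V. (x v)\<^sup>2)"
        using eq_form norm unfolding bil y_def by simp
    qed (rule vV)
    moreover have "m v u * x u \<le> (\<Sum>w\<in>V. m v w * x w)"
      using V(1) vV x_nonneg unfolding m_def by (intro member_le_sum) auto
    ultimately have "m v u * x u \<le> 0" using xv by simp
    moreover have "m v u = 1" using uv V(3) unfolding m_def by (auto simp: sym_def)
    ultimately show False using x_pos[of u] u by auto
  qed
qed

section \<open>Components with constant degree sum along arcs\<close>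

text \<open>For a symmetric relation this is the connected component of \<open>u\<close>.\<close>

definition component :: "'a rel \<Rightarrow> 'a \<Rightarrow> 'a set" where
  "component B u = B\<^sup>* `` {u}"

lemma component_self: "u \<in> component B u"
  unfolding component_def by auto

lemma component_closed: "x \<in> component B u \<Longrightarrow> (x, y) \<in> B \<Longrightarrow> y \<in> component B u"
  unfolding component_def by (auto intro: rtrancl_into_rtrancl)

lemma component_induct [consumes 1, case_names self step]:
  assumes "x \<in> component B u" "P u"
    and "\<And>x y. x \<in> component B u \<Longrightarrow> P x \<Longrightarrow> (x, y) \<in> B \<Longrightarrow> P y"
  shows "P x"
proof -
  have "(u, x) \<in> B\<^sup>*" using assms(1) unfolding component_def by auto
  then show ?thesis
    by (induction rule: rtrancl_induct) (use assms(2,3) in \<open>auto simp: component_def\<close>)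
qed

lemma component_subset:
  assumes "B \<subseteq> V \<times> V" "u \<in> V"
  shows "component B u \<subseteq> V"
proof
  fix x assume "x \<in> component B u"
  then show "x \<in> V" by (induction rule: component_induct) (use assms in auto)
qed

lemma component_degree:
  assumes "x \<in> component B u"
  shows "out_degree (with_proj (induced_graph (component B u) B)) x = card (B `` {x})"
proof -
  have "(B \<inter> component B u \<times> component B u) `` {x} = B `` {x}"
    using assms component_closed[of x B u] by auto
  then show ?thesis by (simp add: out_degree_eq_card_Image)
qed

lemma component_connected:
  assumes "sym B"
  shows "Digraph_Component.connected (with_proj (induced_graph (component B u) B))"
proof -
  let ?C = "component B u"
  let ?E = "B \<inter> ?C \<times> ?C"
  have E: "parcs (mk_symmetric (with_proj (induced_graph ?C B))) = ?E"
    using assms by (auto simp: mk_symmetric_def sym_def)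
  have verts: "pverts (mk_symmetric (with_proj (induced_graph ?C B))) = ?C"
    by (simp add: mk_symmetric_def)
  have from_u: "(u, x) \<in> rtrancl_on ?C ?E" if "x \<in> ?C" for x
    using that
  proof (induction rule: component_induct)
    case self
    show ?case using component_self by (rule rtrancl_on_refl)
  next
    case (step x y)
    have y: "y \<in> ?C" using step.hyps by (rule component_closed)
    then have "(x, y) \<in> ?E" using step.hyps by blast
    with step.IH show ?case using y by (rule rtrancl_on_into_rtrancl_on)
  qed
  have "sym (rtrancl_on ?C ?E)"
  proof (rule rtrancl_on_sym)
    show "sym ?E" using assms by (auto simp: sym_def)
  qed
  then have "(x, u) \<in> rtrancl_on ?C ?E" if "x \<in> ?C" for x
    using from_u[OF that] by (rule symD)
  then have "(x, y) \<in> rtrancl_on ?C ?E" if "x \<in> ?C" "y \<in> ?C" for x y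
    using that from_u rtrancl_on_trans by metis
  moreover have "?C \<noteq> {}" using component_self[of u B] by auto
  ultimately show ?thesis
    unfolding connected_def strongly_connected_def reachable_def with_proj_simps E verts by blast
qed

lemma component_pair_graph:
  assumes "finite V" "B \<subseteq> V \<times> V" "sym B" "irrefl B" "u \<in> V"
  shows "pair_graph (induced_graph (component B u) B)"
  using assms component_subset[of B V u] by (intro pair_graph_induced) (auto intro: finite_subset)

lemma two_degrees_on_component:
  fixes B :: "'a rel" and c :: nat
  assumes "x \<in> component B u" and le: "card (B `` {u}) \<le> c"
    and const: "\<And>x y. x \<in> component B u \<Longrightarrow> (x, y) \<in> B \<Longrightarrow> card (B `` {x}) + card (B `` {y}) = c"
  shows "card (B `` {x}) = card (B `` {u}) \<or> card (B `` {x}) = c - card (B `` {u})"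
  using assms(1)
proof (induction rule: component_induct)
  case (step x y)
  have "card (B `` {x}) + card (B `` {y}) = c" using step.hyps by (rule const)
  then show ?case using step.IH le by linarith
qed simp

lemma regular_component:
  fixes B :: "'a rel"
  assumes V: "finite V" "B \<subseteq> V \<times> V" "sym B" "irrefl B" "u \<in> V"
    and const: "\<And>x y. x \<in> component B u \<Longrightarrow> (x, y) \<in> B \<Longrightarrow> card (B `` {x}) + card (B `` {y}) = c"
    and half: "2 * card (B `` {u}) = c"
  shows "regular_graph (int (card (B `` {u}))) (induced_graph (component B u) B)"
    and "card (B `` {u}) < card (component B u)"
proof -
  have "card (B `` {x}) = card (B `` {u})" if "x \<in> component B u" for x
  proof -
    have "card (B `` {x}) = card (B `` {u}) \<or> card (B `` {x}) = c - card (B `` {u})"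
      using that half const by (intro two_degrees_on_component) auto
    then show ?thesis using half by auto
  qed
  then show "regular_graph (int (card (B `` {u}))) (induced_graph (component B u) B)"
    unfolding regular_graph_def using component_pair_graph[OF V] component_degree[of _ B u] by simp
  have "finite (component B u)" using component_subset[OF V(2,5)] V(1) by (rule finite_subset)
  moreover have "B `` {u} \<subset> component B u"
    using component_self[of u B] component_closed[of u B u] V(4) by (auto simp: irrefl_def)
  ultimately show "card (B `` {u}) < card (component B u)" by (rule psubset_card_mono)
qed

text \<open>The colour classes consist of the vertices of degree \<open>p\<close> and of degree \<open>c - p\<close>. A neighbourhood of
  a vertex of one class lies in the other class, so they have at least \<open>c - p\<close> and at least \<open>p\<close>
  vertices. Counting arcs in both directions excludes that just one vertex is added to this minimum.\<close>

lemma semi_regular_component: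
  fixes B :: "'a rel"
  assumes V: "finite V" "B \<subseteq> V \<times> V" "sym B" "irrefl B" "u \<in> V"
    and const: "\<And>x y. x \<in> component B u \<Longrightarrow> (x, y) \<in> B \<Longrightarrow> card (B `` {x}) + card (B `` {y}) = c"
    and edge: "B `` {u} \<noteq> {}" and not_half: "2 * card (B `` {u}) \<noteq> c"
  obtains p where "1 \<le> p" "2 * p < c" "card (B `` {u}) = p \<or> card (B `` {u}) = c - p"
    "semi_regular_bipartite (int p) (int c - int p) (induced_graph (component B u) B)"
    "c \<le> card (component B u)" "card (component B u) \<noteq> c + 1"
proof -
  let ?C = "component B u"
  let ?d = "\<lambda>x. card (B `` {x})"
  \<comment> \<open>The family needs the smaller degree first, whichever class \<open>u\<close> belongs to.\<close>
  define p where "p = min (?d u) (c - ?d u)"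
  define X Y where "X = {x \<in> ?C. ?d x = p}" and "Y = {x \<in> ?C. ?d x = c - p}"
  have finB: "finite B" using V by (meson finite_SigmaI finite_subset)
  obtain v where v: "(u, v) \<in> B" using edge by auto
  have uC: "u \<in> ?C" and vC: "v \<in> ?C"
    using component_self component_closed[OF component_self v] by auto
  have uv: "?d u + ?d v = c" by (rule const[OF uC v])
  have dpos: "0 < ?d u" "0 < ?d v"
    using v V(3) finB by (auto simp: card_gt_0_iff sym_def)
  have p: "1 \<le> p" "2 * p < c" "?d u = p \<or> ?d u = c - p"
    using uv dpos not_half unfolding p_def by auto
  have C: "?C = X \<union> Y"
  proof -
    have "?d x = ?d u \<or> ?d x = c - ?d u" if "x \<in> ?C" for x
      using that uv const by (intro two_degrees_on_component) auto
    then have "?d x = p \<or> ?d x = c - p" if "x \<in> ?C" for x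
      using that p(2,3) by fastforce
    then show ?thesis unfolding X_def Y_def by auto
  qed
  have disj: "X \<inter> Y = {}" using p(2) unfolding X_def Y_def by auto
  have XY: "B `` {x} \<subseteq> Y" if "x \<in> X" for x
    using that const[of x] component_closed[of x B u] unfolding X_def Y_def by fastforce
  have YX: "B `` {y} \<subseteq> X" if "y \<in> Y" for y
  proof
    fix x assume "x \<in> B `` {y}"
    then have "(y, x) \<in> B" by simp
    then show "x \<in> X"
      using that const[of y x] component_closed[of y B u x] p(2) unfolding X_def Y_def by auto
  qed
  have finC: "finite ?C" using component_subset[OF V(2,5)] V(1) by (rule finite_subset)
  then have fin: "finite X" "finite Y" using C by auto
  have cardC: "card ?C = card X + card Y" unfolding C using fin disj by (rule card_Un_disjoint)
  have "u \<in> X \<and> v \<in> Y \<or> v \<in> X \<and> u \<in> Y"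
    using p(3) uv uC vC p(2) unfolding X_def Y_def by auto
  then obtain x y where xy: "x \<in> X" "y \<in> Y" by blast
  have cardY: "p \<le> card Y" using card_mono[OF fin(2) XY[OF xy(1)]] xy(1) unfolding X_def by auto
  have cardX: "c - p \<le> card X" using card_mono[OF fin(1) YX[OF xy(2)]] xy(2) unfolding Y_def by auto
  \<comment> \<open>Both products count the arcs between the two classes.\<close>
  have count: "card X * p = card Y * (c - p)"
  proof -
    have finImg: "finite (B `` {z})" for z using finB by (rule finite_Image)
    have "card (B \<inter> X \<times> Y) = card (SIGMA x:X. B `` {x})"
      using XY by (intro arg_cong[of _ _ card]) auto
    also have "\<dots> = card X * p" using fin finImg by (simp add: card_SigmaI X_def)
    finally have 1: "card (B \<inter> X \<times> Y) = card X * p" .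
    have "card (B \<inter> Y \<times> X) = card (SIGMA y:Y. B `` {y})"
      using YX by (intro arg_cong[of _ _ card]) auto
    also have "\<dots> = card Y * (c - p)" using fin finImg by (simp add: card_SigmaI Y_def)
    finally have 2: "card (B \<inter> Y \<times> X) = card Y * (c - p)" .
    have "(B \<inter> X \<times> Y)\<inverse> = B \<inter> Y \<times> X" using V(3) by (auto simp: sym_def)
    then show ?thesis using 1 2 card_inverse[of "B \<inter> X \<times> Y"] by simp
  qed
  have "card ?C \<noteq> c + 1"
  proof
    assume "card ?C = c + 1"
    then have "card X + card Y = c + 1" using cardC by simp
    then consider "card X = c - p" "card Y = p + 1" | "card X = c - p + 1" "card Y = p"
      using cardX cardY p(2) by linarith
    moreover define e where "e = c - p"
    moreover have "0 < e" using p(2) unfolding e_def by simp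
    ultimately show False using count p(1) by cases (auto simp: algebra_simps simp flip: e_def)
  qed
  moreover have "semi_regular_bipartite (int p) (int c - int p) (induced_graph ?C B)"
    unfolding semi_regular_bipartite_def
  proof (intro conjI exI2[of _ X Y])
    show "pair_graph (induced_graph ?C B)" by (rule component_pair_graph[OF V])
    show "pverts (induced_graph ?C B) = X \<union> Y" using C by simp
    show "X \<inter> Y = {}" by (rule disj)
    show "parcs (induced_graph ?C B) \<subseteq> X \<times> Y \<union> Y \<times> X"
    proof (rule subrelI)
      fix x y assume "(x, y) \<in> parcs (induced_graph ?C B)"
      then have "(x, y) \<in> B" "x \<in> X \<union> Y" using C by auto
      then show "(x, y) \<in> X \<times> Y \<union> Y \<times> X" using XY[of x] YX[of x] by blast
    qed
    show "\<forall>x\<in>X. int (out_degree (with_proj (induced_graph ?C B)) x) = int p"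
      using component_degree[of _ B u] unfolding X_def by simp
    show "\<forall>y\<in>Y. int (out_degree (with_proj (induced_graph ?C B)) y) = int c - int p"
      using component_degree[of _ B u] p(2) unfolding Y_def by auto
  qed
  moreover have "c \<le> card ?C" using cardX cardY cardC by linarith
  ultimately show thesis using that p by blast
qed

section \<open>Splitting off a complement component as a join factor\<close>

lemma digraph_iso_refl:
  assumes "pair_graph G"
  shows "digraph_iso (with_proj G) (with_proj G)"
proof -
  interpret pair_graph G by fact
  let ?f = "\<lparr>iso_verts = id, iso_arcs = id, iso_head = snd, iso_tail = fst\<rparr>"
  have "digraph_isomorphism ?f"
    unfolding digraph_isomorphism_def using wf_digraph_axioms by simp
  moreover have "with_proj G = app_iso ?f (with_proj G)"
    by (simp add: app_iso_def with_proj_def)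
  ultimately show ?thesis unfolding digraph_iso_def by blast
qed

text \<open>A set that the complement of \<open>G\<close> does not leave is completely joined to the rest in \<open>G\<close>.\<close>

lemma join_decomposition:
  fixes G :: "'a pair_pre_digraph"
  assumes G: "pair_graph G" and C: "C \<subseteq> pverts G"
    and closed: "\<And>x y. x \<in> C \<Longrightarrow> (x, y) \<in> parcs (graph_complement G) \<Longrightarrow> y \<in> C"
  shows "G = graph_join (induced_graph C (parcs G)) (induced_graph (pverts G - C) (parcs G))"
proof -
  have G': "parcs G \<subseteq> pverts G \<times> pverts G" "sym (parcs G)" using G by (auto simp: pair_graph_iff)
  \<comment> \<open>A missing arc between the two sides would be an arc of the complement leaving \<open>C\<close>.\<close>
  have across: "(x, y) \<in> parcs G" if "x \<in> C" "y \<in> pverts G - C" for x y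
    using closed[of x y] that C unfolding graph_complement_def by auto
  then have across': "(y, x) \<in> parcs G" if "x \<in> C" "y \<in> pverts G - C" for x y
    using that G'(2) by (meson symD)
  show ?thesis
  proof (rule pair_pre_digraph.equality)
    show "pverts G = pverts (graph_join (induced_graph C (parcs G)) (induced_graph (pverts G - C) (parcs G)))"
      using C unfolding graph_join_def by auto
    show "parcs G = parcs (graph_join (induced_graph C (parcs G)) (induced_graph (pverts G - C) (parcs G)))"
      using C G'(1) across across' unfolding graph_join_def by auto
  qed simp
qed

lemma complement_induced_graph:
  assumes "pair_graph G" "C \<subseteq> pverts G"
  shows "graph_complement (induced_graph C (parcs (graph_complement G))) = induced_graph C (parcs G)"
    and "graph_complement (induced_graph C (parcs G)) = induced_graph C (parcs (graph_complement G))"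
  using assms unfolding graph_complement_def pair_graph_iff induced_graph_def irrefl_def by auto

lemma spanning_subgraph_of_complete_induced:
  assumes G: "pair_graph G" and C: "C \<subseteq> pverts G" and m: "m = int (card C)"
  shows "spanning_subgraph_of_complete m (induced_graph C (parcs G))"
proof -
  define K where "K = \<lparr>pverts = C, parcs = {(u, v). (u, v) \<in> C \<times> C \<and> u \<noteq> v}\<rparr>"
  have G': "finite C" "sym (parcs G)" "irrefl (parcs G)"
    using G C by (auto simp: pair_graph_iff intro: finite_subset)
  have H: "pair_graph (induced_graph C (parcs G))" using G' by (rule pair_graph_induced)
  have K: "complete_digraph (nat m) (with_proj K)"
    unfolding complete_digraph_pair_def using G'(1) m by (simp add: K_def)
  have pK: "pair_graph K" by (rule pair_graphI_complete[OF K])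
  have wf: "wf_digraph (with_proj (induced_graph C (parcs G)))" "wf_digraph (with_proj K)"
    using H pK by (simp_all add: wf_digraph_wp_iff pair_graph_def pair_digraph_def pair_fin_digraph_def)
  have "spanning (with_proj (induced_graph C (parcs G))) (with_proj K)"
    unfolding spanning_def subgraph_def compatible_def
    using wf G'(3) by (auto simp: K_def irrefl_def)
  then show ?thesis
    unfolding spanning_subgraph_of_complete_def using H K m by auto
qed

text \<open>A vector on \<open>C\<close> is extended by zero to \<open>V\<close>.\<close>

lemma signless_laplacian_radius_induced_le:
  assumes B: "finite V" "B \<subseteq> V \<times> V" "sym B" "irrefl B" and C: "C \<subseteq> V" "C \<noteq> {}"
    and form: "\<And>x. (\<Sum>(u, v)\<in>B. (x u + x v)\<^sup>2) \<le> 2 * b * (\<Sum>v\<in>V. (x v)\<^sup>2)"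
  shows "signless_laplacian_radius (induced_graph C B) \<le> b"
proof -
  have finC: "finite C" using C B by (auto intro: finite_subset)
  have finB: "finite B" using B by (meson finite_SigmaI finite_subset)
  have G: "pair_graph (induced_graph C B)" using finC B(3,4) by (rule pair_graph_induced)
  have "(\<Sum>(u, v)\<in>B \<inter> C \<times> C. (x u + x v)\<^sup>2) \<le> 2 * b * (\<Sum>v\<in>C. (x v)\<^sup>2)" for x
  proof -
    define y where "y = (\<lambda>v. if v \<in> C then x v else 0)"
    have "(\<Sum>(u, v)\<in>B \<inter> C \<times> C. (x u + x v)\<^sup>2) = (\<Sum>(u, v)\<in>B \<inter> C \<times> C. (y u + y v)\<^sup>2)"
      by (intro sum.cong) (auto simp: y_def)
    also have "\<dots> \<le> (\<Sum>(u, v)\<in>B. (y u + y v)\<^sup>2)"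
      using finB by (intro sum_mono2) auto
    also have "\<dots> \<le> 2 * b * (\<Sum>v\<in>V. (y v)\<^sup>2)" by (rule form)
    also have "(\<Sum>v\<in>V. (y v)\<^sup>2) = (\<Sum>v\<in>C. (y v)\<^sup>2)"
      using B(1) C(1) by (intro sum.mono_neutral_right) (auto simp: y_def)
    also have "\<dots> = (\<Sum>v\<in>C. (x v)\<^sup>2)" by (intro sum.cong) (auto simp: y_def)
    finally show ?thesis .
  qed
  then show ?thesis using signless_laplacian_radius_le_iff[OF G] C(2) by simp
qed

lemma component_join:
  fixes G :: "'a pair_pre_digraph"
  assumes G: "pair_graph G" and u: "u \<in> pverts G"
  defines "B \<equiv> parcs (graph_complement G)"
  shows "disjoint_graphs (induced_graph (component B u) B)
      (induced_graph (pverts G - component B u) (parcs G))"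
    and "digraph_iso (with_proj G) (with_proj (graph_join
      (graph_complement (induced_graph (component B u) B))
      (induced_graph (pverts G - component B u) (parcs G))))"
proof -
  have "B \<subseteq> pverts G \<times> pverts G" unfolding B_def graph_complement_def by auto
  then have C: "component B u \<subseteq> pverts G" using u by (rule component_subset)
  show "disjoint_graphs (induced_graph (component B u) B)
      (induced_graph (pverts G - component B u) (parcs G))"
    unfolding disjoint_graphs_def by auto
  have "G = graph_join (induced_graph (component B u) (parcs G))
      (induced_graph (pverts G - component B u) (parcs G))"
    using G C component_closed[of _ B u] unfolding B_def by (intro join_decomposition) auto
  then show "digraph_iso (with_proj G) (with_proj (graph_join
      (graph_complement (induced_graph (component B u) B))
      (induced_graph (pverts G - component B u) (parcs G))))"
    unfolding complement_induced_graph(1)[OF G C, folded B_def] using digraph_iso_refl[OF G] by simp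
qed

text \<open>The parameter \<open>r\<close> is the excess of the component over its minimal size \<open>n - q\<close>; it is at most \<open>q\<close>
  because the component has at most \<open>n\<close> vertices.\<close>

lemma family_B_memberI:
  fixes G :: "'a pair_pre_digraph"
  assumes G: "pair_graph G" and u: "u \<in> pverts G" and n: "card (pverts G) = n"
    and B: "B = parcs (graph_complement G)"
    and semi: "semi_regular_bipartite (int k - (int q - 1)) (int n - int k - 1) (induced_graph (component B u) B)"
    and size: "int n - int q \<le> int (card (component B u))" "int (card (component B u)) \<noteq> int n - int q + 1"
  shows "\<exists>r. G \<in> family_B (int n) (int k) (int q - 1) r"
proof -
  let ?C = "component B u"
  have V: "finite (pverts G)" "B \<subseteq> pverts G \<times> pverts G" "sym B"
    using G pair_graph_complement[OF G] unfolding B by (auto simp: pair_graph_iff graph_complement_def)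
  have C: "?C \<subseteq> pverts G" by (rule component_subset[OF V(2) u])
  have le: "card ?C \<le> n" using card_mono[OF V(1) C] n by simp
  define r where "r = int (card ?C) - (int n - int q)"
  have rest: "int q - r = int (card (pverts G - ?C))"
    using C V(1) n le unfolding r_def by (simp add: card_Diff_subset finite_subset of_nat_diff)
  have "G \<in> family_B (int n) (int k) (int q - 1) r"
    unfolding family_B_def mem_Collect_eq
  proof (intro conjI exI2[of _ "induced_graph ?C B" "induced_graph (pverts G - ?C) (parcs G)"])
    show "spanning_subgraph_of_complete (int q - 1 + 1 - r) (induced_graph (pverts G - ?C) (parcs G))"
      using rest by (intro spanning_subgraph_of_complete_induced[OF G]) auto
    show "int (card (pverts (induced_graph ?C B))) = int n - (int q - 1) - 1 + r"
      unfolding r_def by simp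
  qed (use size le semi component_connected[OF V(3)] component_join[OF G u] in \<open>auto simp: r_def B\<close>)
  then show ?thesis by blast
qed

lemma family_C_memberI:
  fixes G :: "'a pair_pre_digraph"
  assumes G: "pair_graph G" and u: "u \<in> pverts G" and n: "card (pverts G) = n"
    and B: "B = parcs (graph_complement G)"
    and p: "1 \<le> p" "2 * p \<le> int n - int q"
    and semi: "semi_regular_bipartite p (int n - int q - p) (induced_graph (component B u) B)"
    and size: "int n - int q \<le> int (card (component B u))" "int (card (component B u)) \<noteq> int n - int q + 1"
  shows "\<exists>r. G \<in> family_C (int n) (int q - 1) r"
proof -
  let ?C = "component B u"
  have V: "finite (pverts G)" "B \<subseteq> pverts G \<times> pverts G" "sym B"
    using G pair_graph_complement[OF G] unfolding B by (auto simp: pair_graph_iff graph_complement_def)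
  have C: "?C \<subseteq> pverts G" by (rule component_subset[OF V(2) u])
  have le: "card ?C \<le> n" using card_mono[OF V(1) C] n by simp
  define r where "r = int (card ?C) - (int n - int q)"
  have rest: "int q - r = int (card (pverts G - ?C))"
    using C V(1) n le unfolding r_def by (simp add: card_Diff_subset finite_subset of_nat_diff)
  have "G \<in> family_C (int n) (int q - 1) r"
    unfolding family_C_def mem_Collect_eq
  proof (intro conjI exI[of _ p] exI2[of _ "induced_graph ?C B" "induced_graph (pverts G - ?C) (parcs G)"])
    show "spanning_subgraph_of_complete (int q - 1 + 1 - r) (induced_graph (pverts G - ?C) (parcs G))"
      using rest by (intro spanning_subgraph_of_complete_induced[OF G]) auto
    show "int (card (pverts (induced_graph ?C B))) = int n - (int q - 1) - 1 + r"
      unfolding r_def by simp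
  qed (use p size le semi component_connected[OF V(3)] component_join[OF G u] in \<open>auto simp: r_def B\<close>)
  then show ?thesis by blast
qed

text \<open>Here \<open>r\<close> counts the vertices outside the component. The upper bound on \<open>r\<close> comes from a
  \<open>d\<close>-regular graph having more than \<open>d\<close> vertices.\<close>

lemma family_W_memberI:
  fixes G :: "'a pair_pre_digraph"
  assumes G: "pair_graph G" and u: "u \<in> pverts G" and n: "card (pverts G) = n"
    and B: "B = parcs (graph_complement G)"
    and d: "2 * d = int n - int q" "d < int (card (component B u))"
    and reg: "regular_graph d (induced_graph (component B u) B)"
    and form: "\<And>x. (\<Sum>(u, v)\<in>B. (x u + x v)\<^sup>2) \<le> 2 * real_of_int (int n - int q) * (\<Sum>v\<in>pverts G. (x v)\<^sup>2)"
  shows "\<exists>r. G \<in> family_W (int n) (int q - 1) r"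
proof -
  let ?C = "component B u"
  have V: "finite (pverts G)" "B \<subseteq> pverts G \<times> pverts G" "sym B" "irrefl B"
    using G pair_graph_complement[OF G] unfolding B by (auto simp: pair_graph_iff graph_complement_def)
  have C: "?C \<subseteq> pverts G" by (rule component_subset[OF V(2) u])
  have le: "card ?C \<le> n" using card_mono[OF V(1) C] n by simp
  define r where "r = int n - int (card ?C)"
  have rest: "r = int (card (pverts G - ?C))"
    using C V(1) n le unfolding r_def by (simp add: card_Diff_subset finite_subset of_nat_diff)
  have "G \<in> family_W (int n) (int q - 1) r"
    unfolding family_W_def mem_Collect_eq
  proof (intro conjI exI[of _ d] exI2[of _ "induced_graph ?C B" "induced_graph (pverts G - ?C) (parcs G)"])
    show "spanning_subgraph_of_complete r (induced_graph (pverts G - ?C) (parcs G))"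
      using rest by (intro spanning_subgraph_of_complete_induced[OF G]) auto
    show "pverts (induced_graph (pverts G - ?C) (parcs G)) \<noteq> {} \<longrightarrow>
        signless_laplacian_radius (graph_complement (induced_graph (pverts G - ?C) (parcs G)))
          \<le> real_of_int (int n - (int q - 1) - 1)"
    proof
      assume "pverts (induced_graph (pverts G - ?C) (parcs G)) \<noteq> {}"
      then have "signless_laplacian_radius (induced_graph (pverts G - ?C) B) \<le> real_of_int (int n - int q)"
        by (intro signless_laplacian_radius_induced_le[OF V _ _ form]) auto
      moreover have "graph_complement (induced_graph (pverts G - ?C) (parcs G)) = induced_graph (pverts G - ?C) B"
        unfolding B by (rule complement_induced_graph(2)[OF G]) auto
      ultimately show "signless_laplacian_radius (graph_complement (induced_graph (pverts G - ?C) (parcs G)))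
          \<le> real_of_int (int n - (int q - 1) - 1)" by simp
    qed
    show "0 \<le> r" using le unfolding r_def by simp
    have "d + 1 \<le> int (card ?C)" using d(2) by simp
    then show "2 * r \<le> int n + (int q - 1) - 1" using d(1) unfolding r_def by presburger
    show "int (card (pverts (induced_graph ?C B))) = int n - r" unfolding r_def by simp
  qed (use d reg component_connected[OF V(3)] component_join[OF G u] in \<open>auto simp: B\<close>)
  then show ?thesis by blast
qed

text \<open>\<open>W\<close> may be a union of several components of the complement: the first join factor has to be regular,
  and it is, being the complement of a regular graph.\<close>

lemma family_H_memberI:
  fixes G :: "'a pair_pre_digraph"
  assumes G: "pair_graph G" and n: "card (pverts G) = n"
    and B: "B = parcs (graph_complement G)"
    and W: "W \<subseteq> pverts G" "W \<noteq> {}" "\<And>x y. x \<in> W \<Longrightarrow> (x, y) \<in> B \<Longrightarrow> y \<in> W"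
    and deg: "\<And>x. x \<in> W \<Longrightarrow> card (B `` {x}) = n - 1 - k"
    and nk: "n + q = 2 * k + 2" "2 * k \<le> n"
  shows "\<exists>r. G \<in> family_H (int n) (int k) (int q - 1) r"
proof -
  have V: "finite (pverts G)" "B \<subseteq> pverts G \<times> pverts G" "sym B" "irrefl B"
    and E: "sym (parcs G)" "irrefl (parcs G)"
    using G pair_graph_complement[OF G] unfolding B by (auto simp: pair_graph_iff graph_complement_def)
  have finW: "finite W" using W(1) V(1) by (rule finite_subset)
  have le: "card W \<le> n" using card_mono[OF V(1) W(1)] n by simp
  have kn: "k < n" using nk W(1,2) n V(1) by (cases k) (auto simp: card_gt_0_iff)
  define r where "r = int (card W) - (int n - int k)"
  have degW: "int (card (parcs (induced_graph W (parcs G)) `` {x})) = r" if x: "x \<in> W" for x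
  proof -
    have Bx: "B `` {x} \<subseteq> W" using W(3) x by auto
    have "W - {x} = parcs (induced_graph W (parcs G)) `` {x} \<union> B `` {x}"
      using x W Bx E(2) unfolding B graph_complement_def by (auto simp: irrefl_def)
    moreover have "parcs (induced_graph W (parcs G)) `` {x} \<inter> B `` {x} = {}"
      unfolding B graph_complement_def by auto
    moreover have "finite (B `` {x})" "finite (parcs (induced_graph W (parcs G)) `` {x})"
      using finW Bx by (auto intro: finite_subset)
    ultimately have "card W - 1 = card (parcs (induced_graph W (parcs G)) `` {x}) + (n - 1 - k)"
      using x finW deg[OF x] by (metis card_Diff_singleton card_Un_disjoint)
    moreover have "0 < card W" using W(2) finW by (simp add: card_gt_0_iff)
    ultimately show ?thesis using kn unfolding r_def by linarith
  qed
  have r0: "0 \<le> r" using degW W(2) by (metis all_not_in_conv of_nat_0_le_iff)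
  have rest: "int k - r = int (card (pverts G - W))"
    using W V(1) n le finW unfolding r_def by (simp add: card_Diff_subset of_nat_diff)
  have "G \<in> family_H (int n) (int k) (int q - 1) r"
    unfolding family_H_def mem_Collect_eq
  proof (intro conjI exI2[of _ "induced_graph W (parcs G)" "induced_graph (pverts G - W) (parcs G)"])
    show "spanning_subgraph_of_complete (int k - r) (induced_graph (pverts G - W) (parcs G))"
      using rest by (intro spanning_subgraph_of_complete_induced[OF G]) auto
    show "regular_graph r (induced_graph W (parcs G))"
      unfolding regular_graph_def out_degree_eq_card_Image
      using degW pair_graph_induced[OF finW E] by simp
    show "disjoint_graphs (induced_graph W (parcs G)) (induced_graph (pverts G - W) (parcs G))"
      unfolding disjoint_graphs_def by auto
    have "G = graph_join (induced_graph W (parcs G)) (induced_graph (pverts G - W) (parcs G))"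
      using W unfolding B by (intro join_decomposition[OF G]) auto
    then show "digraph_iso (with_proj G)
        (with_proj (graph_join (induced_graph W (parcs G)) (induced_graph (pverts G - W) (parcs G))))"
      using digraph_iso_refl[OF G] by simp
  qed (use nk r0 le in \<open>auto simp: r_def\<close>)
  then show ?thesis by blast
qed

section \<open>The two dichotomies\<close>

text \<open>Both this lemma and \<open>degree_product_ge\<close> rest on the identity
  \<open>x y = a b + x (x + y - a - b) + (x - a) (b - x)\<close>, in which the last two terms are nonnegative.\<close>

lemma extremal_pair:
  fixes x y a b :: nat
  assumes "x \<le> b" "y \<le> b" "a + b \<le> x + y" "x * y = a * b" "a \<le> b"
  shows "x + y = a + b" "x = a \<or> x = b"
proof -
  define X Y A C where "X = int x" and "Y = int y" and "A = int a" and "C = int b"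
  have le: "0 \<le> A" "0 \<le> X" "A \<le> X" "X \<le> C" "Y \<le> C" "A + C \<le> X + Y"
    using assms unfolding X_def Y_def A_def C_def by linarith+
  have "X * Y = A * C" using assms(4) unfolding X_def Y_def A_def C_def by (simp flip: of_nat_mult)
  then have "X * (X + Y - (A + C)) + (X - A) * (C - X) = 0" by (simp add: algebra_simps)
  moreover have nn: "0 \<le> X * (X + Y - (A + C))" "0 \<le> (X - A) * (C - X)" using le by simp_all
  ultimately have zero: "X * (X + Y - (A + C)) = 0" "(X - A) * (C - X) = 0" by linarith+
  show "x = a \<or> x = b" using zero(2) unfolding X_def A_def C_def by auto
  have "X + Y = A + C" using zero(1) le by auto
  then show "x + y = a + b" unfolding X_def Y_def A_def C_def by linarith
qed

lemma degree_product_ge: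
  fixes x y a b :: nat
  assumes "x \<le> b" "y \<le> b" "a + b \<le> x + y"
  shows "a * b \<le> x * y"
proof -
  define X Y A C where "X = int x" and "Y = int y" and "A = int a" and "C = int b"
  have le: "0 \<le> X" "A \<le> X" "X \<le> C" "A + C \<le> X + Y"
    using assms unfolding X_def Y_def A_def C_def by linarith+
  have "X * Y = A * C + (X * (X + Y - (A + C)) + (X - A) * (C - X))" by (simp add: algebra_simps)
  moreover have "0 \<le> X * (X + Y - (A + C))" "0 \<le> (X - A) * (C - X)" using le by simp_all
  ultimately have "A * C \<le> X * Y" by linarith
  then show ?thesis unfolding X_def Y_def A_def C_def by (simp flip: of_nat_mult)
qed

text \<open>With \<open>a = k + 1 - q\<close> and \<open>b = n - 1 - k\<close>, the minimum degree bounds all complement degrees by \<open>b\<close>, which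
  turns the lower bound \<open>a + b\<close> on degree sums into the lower bound \<open>a b\<close> on degree products. If
  \<open>a < b\<close>, the degrees \<open>a\<close> and \<open>b\<close> alternate along a component; if \<open>a = b\<close>, all covered vertices have
  degree \<open>b\<close>.\<close>

lemma spectral_radius_dichotomy:
  fixes G :: "'a pair_pre_digraph"
  assumes G: "pair_graph G" and n: "card (pverts G) = n" and none: "\<not> q_traceable q G"
    and nk: "2 * k \<le> n" "2 * k + 2 \<le> n + q"
    and deg: "k \<le> min_degree G" and kq: "q \<le> k + 1"
    and radius: "adj_spectral_radius (graph_complement G)
        \<le> sqrt ((real k + 1 - real q) * (real n - real k - 1))"
  shows "\<exists>r. G \<in> family_B (int n) (int k) (int q - 1) r \<union> family_H (int n) (int k) (int q - 1) r"
proof -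
  define B where "B = parcs (graph_complement G)"
  obtain F where F: "F \<subseteq> B" "sym F" "F \<noteq> {}"
      and heavy: "\<And>u v. (u, v) \<in> F \<Longrightarrow> n \<le> card (F `` {u}) + card (F `` {v}) + q"
    using not_q_traceable_heavy_coedges[OF G none] n unfolding B_def by blast
  have graphB: "pair_graph (graph_complement G)" by (rule pair_graph_complement[OF G])
  have V: "finite (pverts G)" "B \<subseteq> pverts G \<times> pverts G" "sym B" "irrefl B"
    using G graphB unfolding B_def by (auto simp: pair_graph_iff graph_complement_def)
  have finB: "finite B" using V by (meson finite_SigmaI finite_subset)
  obtain u v where uv: "(u, v) \<in> F" using F(3) by auto
  then have u: "u \<in> pverts G" "(u, v) \<in> B" using F(1) V(2) by auto
  then have ne: "pverts G \<noteq> {}" by auto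
  have kn: "k < n"
  proof -
    have "0 < n" using u V(1) n by (auto simp: card_gt_0_iff)
    then show ?thesis using nk(1) by linarith
  qed
  define a b where "a = k + 1 - q" and "b = n - 1 - k"
  have ab: "a + b = n - q" "a \<le> b" "q \<le> n" using nk kq kn unfolding a_def b_def by linarith+
  have degB: "card (B `` {x}) \<le> b" if x: "x \<in> pverts G" for x
  proof -
    have "k \<le> out_degree (with_proj G) x"
      using deg x V(1) unfolding min_degree_def by (meson Min_le finite_imageI imageI order_trans)
    then have "k \<le> card (parcs G `` {x})" unfolding out_degree_eq_card_Image .
    moreover have "card (parcs G `` {x}) + card (B `` {x}) \<le> n - 1"
    proof -
      have sub: "parcs G `` {x} \<union> B `` {x} \<subseteq> pverts G - {x}"
        using G V(2,4) unfolding pair_graph_iff irrefl_def by auto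
      have "parcs G `` {x} \<inter> B `` {x} = {}" unfolding B_def graph_complement_def by auto
      moreover have "finite (parcs G `` {x})" "finite (B `` {x})"
        using sub V(1) by (auto intro: finite_subset)
      ultimately have "card (parcs G `` {x}) + card (B `` {x}) = card (parcs G `` {x} \<union> B `` {x})"
        by (simp add: card_Un_disjoint)
      also have "\<dots> \<le> card (pverts G - {x})" using sub V(1) by (intro card_mono) auto
      also have "\<dots> = n - 1" using x n by (simp add: card_Diff_singleton)
      finally show ?thesis .
    qed
    ultimately show ?thesis unfolding b_def by linarith
  qed
  have degF: "card (F `` {x}) \<le> b" if "x \<in> pverts G" for x
  proof -
    have "card (F `` {x}) \<le> card (B `` {x})"
      using F(1) finB by (intro card_mono finite_Image) auto
    then show ?thesis using degB[OF that] by linarith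
  qed
  define c where "c = sqrt (real a * real b)"
  have c: "0 \<le> c" "c\<^sup>2 = real a * real b" unfolding c_def by auto
  have arc: "x \<in> pverts G" "y \<in> pverts G" "a + b \<le> card (F `` {x}) + card (F `` {y})"
    if "(x, y) \<in> F" for x y
    using that F(1) V(2) heavy[OF that] ab by auto
  have prod: "a * b \<le> card (F `` {x}) * card (F `` {y})" if xy: "(x, y) \<in> F" for x y
    using degF[OF arc(1)[OF xy]] degF[OF arc(2)[OF xy]] arc(3)[OF xy] by (rule degree_product_ge)
  have form: "(\<Sum>(u, v)\<in>B. x u * x v) \<le> c * (\<Sum>v\<in>pverts G. (x v)\<^sup>2)" for x
  proof -
    have "sqrt ((real k + 1 - real q) * (real n - real k - 1)) = c"
    proof -
      have "real a = real k + 1 - real q" "real b = real n - real k - 1"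
        using kq kn unfolding a_def b_def by auto
      then show ?thesis unfolding c_def by simp
    qed
    then show ?thesis
      using radius ne adj_spectral_radius_le_iff[OF graphB] by (simp add: B_def graph_complement_def)
  qed
  have heavy_prod: "c\<^sup>2 \<le> real (card (F `` {x})) * real (card (F `` {y}))" if "(x, y) \<in> F" for x y
    using prod[OF that] unfolding c(2) by (simp flip: of_nat_mult)
  have product: "real (card (F `` {x})) * real (card (F `` {y})) = c\<^sup>2" if "(x, y) \<in> F" for x y
    by (rule arcs_equal_of_degree_products(1)[OF V(1-3) F(1,2) c(1) _ _ that])
       (erule heavy_prod, rule form)
  have full: "(x, y) \<in> F" if "(x, y) \<in> B" "F `` {x} \<noteq> {}" for x y
    by (rule arcs_equal_of_degree_products(2)[OF V(1-3) F(1,2) c(1) _ _ that])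
       (erule heavy_prod, rule form)
  define W where "W = {x. F `` {x} \<noteq> {}}"
  have uW: "u \<in> W" using uv unfolding W_def by auto
  have W: "W \<subseteq> pverts G" using F(1) V(2) unfolding W_def by auto
  have FB: "(x, y) \<in> F" "y \<in> W" if "x \<in> W" "(x, y) \<in> B" for x y
    using full[OF that(2)] that(1) F(2) unfolding W_def by (auto dest: symD)
  have imgW: "F `` {x} = B `` {x}" if "x \<in> W" for x using FB[OF that] F(1) by auto
  have CW: "x \<in> W" if "x \<in> component B u" for x
    using that by (induction rule: component_induct) (use uW FB(2) in auto)
  have degs: "card (B `` {x}) + card (B `` {y}) = a + b" "card (B `` {x}) = a \<or> card (B `` {x}) = b"
    if x: "x \<in> W" and xy: "(x, y) \<in> B" for x y
  proof -
    have xyF: "(x, y) \<in> F" by (rule FB(1)[OF x xy])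
    have "real (card (F `` {x}) * card (F `` {y})) = real (a * b)"
      using product[OF xyF] unfolding c(2) by simp
    then have "card (F `` {x}) * card (F `` {y}) = a * b" unfolding of_nat_eq_iff .
    note pair = extremal_pair[OF degF[OF arc(1)[OF xyF]] degF[OF arc(2)[OF xyF]] arc(3)[OF xyF] this ab(2)]
    show "card (B `` {x}) + card (B `` {y}) = a + b" "card (B `` {x}) = a \<or> card (B `` {x}) = b"
      using pair imgW[OF x] imgW[OF FB(2)[OF x xy]] by simp_all
  qed
  show ?thesis
  proof (cases "a = b")
    case True
    have "card (B `` {x}) = n - 1 - k" if x: "x \<in> W" for x
    proof -
      obtain y where "(x, y) \<in> B" using x F(1) unfolding W_def by auto
      then show ?thesis using degs(2)[OF x] True unfolding b_def by auto
    qed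
    moreover have "n + q = 2 * k + 2" using True kq kn unfolding a_def b_def by linarith
    ultimately have "\<exists>r. G \<in> family_H (int n) (int k) (int q - 1) r"
      using uW FB(2) nk(1) by (intro family_H_memberI[OF G n B_def W]) auto
    then show ?thesis by blast
  next
    case False
    have const: "card (B `` {x}) + card (B `` {y}) = a + b" if "x \<in> component B u" "(x, y) \<in> B" for x y
      using degs(1) CW that by blast
    have "2 * card (B `` {u}) \<noteq> a + b" using degs(2)[OF uW u(2)] False by auto
    moreover have "B `` {u} \<noteq> {}" using u(2) by auto
    ultimately obtain p where p: "2 * p < a + b" "card (B `` {u}) = p \<or> card (B `` {u}) = a + b - p"
        "semi_regular_bipartite (int p) (int (a + b) - int p) (induced_graph (component B u) B)"
        "a + b \<le> card (component B u)" "card (component B u) \<noteq> a + b + 1"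
      using semi_regular_component[OF V u(1) const] by metis
    have "p = a" using p(1,2) degs(2)[OF uW u(2)] ab(2) by auto
    then have eqs: "int p = int k - (int q - 1)" "int (a + b) - int p = int n - int k - 1"
      using kq kn unfolding a_def b_def by auto
    have "semi_regular_bipartite (int k - (int q - 1)) (int n - int k - 1) (induced_graph (component B u) B)"
      using p(3) unfolding eqs(2) unfolding eqs(1) .
    then have "\<exists>r. G \<in> family_B (int n) (int k) (int q - 1) r"
      using p(4,5) ab(1,3) by (intro family_B_memberI[OF G u(1) n B_def]) auto
    then show ?thesis by blast
  qed
qed

lemma signless_radius_dichotomy:
  fixes G :: "'a pair_pre_digraph"
  assumes G: "pair_graph G" and n: "card (pverts G) = n" and none: "\<not> q_traceable q G"
    and qn: "q \<le> n"
    and radius: "signless_laplacian_radius (graph_complement G) \<le> real n - real q"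
  shows "\<exists>r. G \<in> family_C (int n) (int q - 1) r \<union> family_W (int n) (int q - 1) r"
proof -
  define B where "B = parcs (graph_complement G)"
  obtain F where F: "F \<subseteq> B" "sym F" "F \<noteq> {}"
      and heavy: "\<And>u v. (u, v) \<in> F \<Longrightarrow> n \<le> card (F `` {u}) + card (F `` {v}) + q"
    using not_q_traceable_heavy_coedges[OF G none] n unfolding B_def by blast
  have graphB: "pair_graph (graph_complement G)" by (rule pair_graph_complement[OF G])
  have V: "finite (pverts G)" "B \<subseteq> pverts G \<times> pverts G" "sym B" "irrefl B"
    using G graphB unfolding B_def by (auto simp: pair_graph_iff graph_complement_def)
  obtain u v where uv: "(u, v) \<in> F" using F(3) by auto
  then have u: "u \<in> pverts G" "(u, v) \<in> B" using F(1) V(2) by auto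
  then have ne: "pverts G \<noteq> {}" by auto
  define c where "c = n - q"
  have c: "int c = int n - int q" "real c = real n - real q"
    using qn unfolding c_def by (auto simp: of_nat_diff)
  have heavy_c: "c \<le> card (F `` {x}) + card (F `` {y})" if "(x, y) \<in> F" for x y
    using heavy[OF that] unfolding c_def by linarith
  have form: "(\<Sum>(u, v)\<in>B. (x u + x v)\<^sup>2) \<le> 2 * real c * (\<Sum>v\<in>pverts G. (x v)\<^sup>2)" for x
    using radius ne signless_laplacian_radius_le_iff[OF graphB, of "real c"]
    unfolding c(2) by (simp add: B_def graph_complement_def)
  have sums: "card (F `` {x}) + card (F `` {y}) = c" if "(x, y) \<in> F" for x y
    by (rule arcs_equal_of_degree_sums(1)[OF V(1,2) F(1,2) _ _ that]) (erule heavy_c, rule form)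
  have full: "(x, y) \<in> F" if "(x, y) \<in> B" "F `` {x} \<noteq> {}" for x y
    by (rule arcs_equal_of_degree_sums(2)[OF V(1,2) F(1,2) _ _ that]) (erule heavy_c, rule form)
  define W where "W = {x. F `` {x} \<noteq> {}}"
  have uW: "u \<in> W" using uv unfolding W_def by auto
  have FB: "(x, y) \<in> F" "y \<in> W" if "x \<in> W" "(x, y) \<in> B" for x y
    using full[OF that(2)] that(1) F(2) unfolding W_def by (auto dest: symD)
  have imgW: "F `` {x} = B `` {x}" if "x \<in> W" for x using FB[OF that] F(1) by auto
  have CW: "x \<in> W" if "x \<in> component B u" for x
    using that by (induction rule: component_induct) (use uW FB(2) in auto)
  have const: "card (B `` {x}) + card (B `` {y}) = c" if "x \<in> component B u" "(x, y) \<in> B" for x y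
    using sums[OF FB(1)[OF CW[OF that(1)] that(2)]] imgW[OF CW[OF that(1)]]
      imgW[OF FB(2)[OF CW[OF that(1)] that(2)]] by simp
  show ?thesis
  proof (cases "2 * card (B `` {u}) = c")
    case True
    have "\<exists>r. G \<in> family_W (int n) (int q - 1) r"
      using regular_component[OF V u(1) const True] True form c
      by (intro family_W_memberI[OF G u(1) n B_def, where d = "int (card (B `` {u}))"]) auto
    then show ?thesis by blast
  next
    case False
    have "B `` {u} \<noteq> {}" using u(2) by auto
    then obtain p where p: "1 \<le> p" "2 * p < c"
        "semi_regular_bipartite (int p) (int c - int p) (induced_graph (component B u) B)"
        "c \<le> card (component B u)" "card (component B u) \<noteq> c + 1"
      using semi_regular_component[OF V u(1) const _ False] by metis
    have "\<exists>r. G \<in> family_C (int n) (int q - 1) r"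
      using p c(1) by (intro family_C_memberI[OF G u(1) n B_def, where p = "int p"]) auto
    then show ?thesis by blast
  qed
qed

theorem corollary1p9:
  fixes n k q :: nat and G :: "'a pair_pre_digraph"
  assumes "pair_graph G" and "card (pverts G) = n"
  shows
    "(int n \<ge> max (2 * int k) (2 * int k + 2 - int q) \<and>
      int (min_degree G) \<ge> int k \<and> int k \<ge> max (int q - 1) 1 \<and>
      adj_spectral_radius (graph_complement G)
        \<le> sqrt ((real k + 1 - real q) * (real n - real k - 1))
      \<longrightarrow>
      q_traceable q G \<or>
      (\<exists>r. G \<in> family_B (int n) (int k) (int q - 1) r \<union> family_H (int n) (int k) (int q - 1) r) \<or>
      (join_of_costars k G \<and> q = k))
     \<and>
     (int n \<ge> 3 * int q - 1 \<and>
      signless_laplacian_radius (graph_complement G) \<le> real n - real q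
      \<longrightarrow>
      q_traceable q G \<or>
      (\<exists>r. G \<in> family_C (int n) (int q - 1) r \<union> family_D (int n) (int q - 1) r
                 \<union> family_W (int n) (int q - 1) r))"
proof (cases "q_traceable q G")
  case True
  then show ?thesis by blast
next
  case False
  show ?thesis
  proof (intro conjI impI; elim conjE)
    assume *: "int n \<ge> max (2 * int k) (2 * int k + 2 - int q)" "int (min_degree G) \<ge> int k"
      "int k \<ge> max (int q - 1) 1"
      "adj_spectral_radius (graph_complement G) \<le> sqrt ((real k + 1 - real q) * (real n - real k - 1))"
    have "2 * k \<le> n" "2 * k + 2 \<le> n + q" "k \<le> min_degree G" "q \<le> k + 1" using * by linarith+
    then have "\<exists>r. G \<in> family_B (int n) (int k) (int q - 1) r \<union> family_H (int n) (int k) (int q - 1) r"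
      using *(4) by (intro spectral_radius_dichotomy[OF assms False])
    then show "q_traceable q G \<or>
        (\<exists>r. G \<in> family_B (int n) (int k) (int q - 1) r \<union> family_H (int n) (int k) (int q - 1) r) \<or>
        (join_of_costars k G \<and> q = k)" by blast
  next
    assume *: "int n \<ge> 3 * int q - 1" "signless_laplacian_radius (graph_complement G) \<le> real n - real q"
    have "q \<le> n" using *(1) by linarith
    then have "\<exists>r. G \<in> family_C (int n) (int q - 1) r \<union> family_W (int n) (int q - 1) r"
      using *(2) by (intro signless_radius_dichotomy[OF assms False])
    then show "q_traceable q G \<or>
        (\<exists>r. G \<in> family_C (int n) (int q - 1) r \<union> family_D (int n) (int q - 1) r
           \<union> family_W (int n) (int q - 1) r)" by blast
  qed
qed

end
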